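(* Consider the map from Baxter slicings to triples of non-intersecting lattice paths defined below. The image of the set of Schröder slicings under this map is exactly the set of Schröder triples of non-intersecting lattice paths. Hence this map restricts to a size-preserving bijection between Schröder slicings and Schröder triples of non-intersecting lattice paths. The map is defined as follows. Place a Baxter slicing of $P$ with bottom-left corner at $(0,0)$. Then: - $u$ is the upper border of $P$ without its first and last steps, translated to start at $(0,2)$; - $d$ is the lower border of $P$ without its first and last steps, translated to start at $(2,0)$; - $m$ is the path from $(1,1)$ to the top-right corner of $P$ following the lower border of every horizontal block and the left border of every vertical block. The slicing is sent to $(u,m,d)$.
   Context: Parallelogram polyominoes are edge-connected sets of unit cells bounded by two $N=(0,1)$/$E=(1,0)$ lattice paths meeting only at their endpoints. The size is $k+\ell-1$ for a $k\times\ell$ bounding rectangle. A Baxter slicing of size $n$ is such a polyomino $P$ divided into $n$ blocks, defined recursively: - for $n=1$, the single cell is the single block; - for $n\ge2$, one block is either the topmost row (horizontal block) or the rightmost column (vertical block), and the other blocks form a Baxter slicing of the remainder. For a horizontal block $u$: - $\ell(u)$ is its width; - $X(u)$ is the lowest point of the lower border of $P$ with the abscissa of the right edge of $u$; - $r(u)$ is the number of horizontal steps of the lower border read leftwards from $X(u)$ before a vertical step or the bottom-left corner is met. A Schröder slicing is a Baxter slicing with $\ell(u)\le r(u)+1$ for every horizontal block $u$. A path of size $n$ is a sequence of $n-1$ steps, each $N$ or $E$. A triple of non-intersecting lattice paths of size $n$ is a triple $(u,m,d)$ of paths of size $n$ with the same number of $E$ steps, starting respectively at $(0,2)$, $(1,1)$,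 $(2,0)$, whose embeddings never meet. In such a triple: - an $N$ step $N_u$ of $u$ and an $N$ step $N_m$ of $m$ are matched if, for some $i$, each is the $i$-th $N$ step of its path; - likewise, $E$ steps $E_m$ of $m$ and $E_d$ of $d$ are matched if, for some $i$, each is the $i$-th $E$ step of its path; - $h_u(N_u)$ (resp. $h_m(N_m)$) is the number of $E$ steps of $u$ (resp. $m$) before $N_u$ (resp. $N_m$); - for an $E$ step $E_d$ of $d$, $k_d(E_d)$ is the largest $k$ such that $E^k$ is a factor of $d$ ending at $E_d$. A Schröder triple is a triple such that the following holds for every $N$ step $N_u$ of $u$. Let $N_m$ be the $N$ step of $m$ matched with $N_u$, let $E_m$ be the last $E$ step of $m$ before $N_m$, and let $E_d$ be the $E$ step of $d$ matched with $E_m$. Then $h_u(N_u)-h_m(N_m)\le k_d(E_d)$.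
   Formalization: The Schröder triple condition is taken as h_m(N_m) − h_u(N_u) ≤ k_d(E_d); the printed h_u(N_u) − h_m(N_m) ≤ k_d(E_d) holds for every triple and makes the claim false, e.g. for (NNEE, NEEN, ENEN), whose slicing is not Schröder. *)

theory Defs
  imports Main "HOL-Library.Sublist"
begin

text \<open>A cell is named by its lower-left corner. Polyominoes are taken with the bottom-left corner
  of their bounding rectangle at the origin, so translation classes are represented by sets
  of pairs of naturals.\<close>

datatype step = N | E

type_synonym path = "step list"
type_synonym point = "nat \<times> nat"
type_synonym cell = "nat \<times> nat"

definition endpoint :: "point \<Rightarrow> path \<Rightarrow> point" where
  "endpoint p w = (fst p + count_list w E, snd p + count_list w N)"

text \<open>Lattice points visited by \<open>w\<close> when started at \<open>p\<close>. The embeddings of two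
  lattice paths meet if and only if they share such a point.\<close>

definition vertices :: "point \<Rightarrow> path \<Rightarrow> point set" where
  "vertices p w = {endpoint p v | v. prefix v w}"

text \<open>A step of a path \<open>w\<close> is identified by the part \<open>v\<close> of \<open>w\<close> that precedes it.\<close>

definition is_step :: "step \<Rightarrow> path \<Rightarrow> path \<Rightarrow> bool" where
  "is_step s w v \<longleftrightarrow> prefix (v @ [s]) w"

definition step_starts :: "step \<Rightarrow> point \<Rightarrow> path \<Rightarrow> point set" where
  "step_starts s p w = {endpoint p v | v. is_step s w v}"

text \<open>The largest \<open>k\<close> such that \<open>w\<close> ends with \<open>k\<close> consecutive \<open>E\<close> steps.\<close>

definition east_run :: "path \<Rightarrow> nat" where
  "east_run w = (GREATEST k. suffix (replicate k E) w)"


section \<open>Parallelogram polyominoes\<close>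

definition adjacent :: "cell \<Rightarrow> cell \<Rightarrow> bool" where
  "adjacent a b \<longleftrightarrow>
     (fst a = fst b \<and> (snd b = Suc (snd a) \<or> snd a = Suc (snd b))) \<or>
     (snd a = snd b \<and> (fst b = Suc (fst a) \<or> fst a = Suc (fst b)))"

definition edge_connected :: "cell set \<Rightarrow> bool" where
  "edge_connected P \<longleftrightarrow>
     (\<forall>a\<in>P. \<forall>b\<in>P. (a, b) \<in> {(c, c'). c \<in> P \<and> c' \<in> P \<and> adjacent c c'}\<^sup>*)"

text \<open>\<open>U\<close> and \<open>D\<close> are two paths from the origin that meet exactly at their endpoints, \<open>U\<close> being
  the upper one, and \<open>P\<close> is the set of cells between them: the cells of column \<open>x\<close> lie
  between the \<open>E\<close> step of \<open>D\<close> (at height \<open>a\<close>) and that of \<open>U\<close> (at height \<open>b\<close>) above abscissa \<open>x\<close>.\<close>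

definition bounded_by :: "cell set \<Rightarrow> path \<Rightarrow> path \<Rightarrow> bool" where
  "bounded_by P U D \<longleftrightarrow>
     prefix [N] U \<and> prefix [E] D \<and>
     endpoint (0, 0) U = endpoint (0, 0) D \<and>
     vertices (0, 0) U \<inter> vertices (0, 0) D = {(0, 0), endpoint (0, 0) U} \<and>
     P = {(x, y). \<exists>a b. (x, a) \<in> step_starts E (0, 0) D \<and> (x, b) \<in> step_starts E (0, 0) U \<and>
                         a \<le> y \<and> y < b}"

definition parallelogram_polyomino :: "cell set \<Rightarrow> bool" where
  "parallelogram_polyomino P \<longleftrightarrow> edge_connected P \<and> (\<exists>U D. bounded_by P U D)"

definition upper_border :: "cell set \<Rightarrow> path" where
  "upper_border P = (THE U. \<exists>D. bounded_by P U D)"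

definition lower_border :: "cell set \<Rightarrow> path" where
  "lower_border P = (THE D. \<exists>U. bounded_by P U D)"

definition width :: "cell set \<Rightarrow> nat" where
  "width A = Max (fst ` A) - Min (fst ` A) + 1"

definition height :: "cell set \<Rightarrow> nat" where
  "height A = Max (snd ` A) - Min (snd ` A) + 1"

definition polyomino_size :: "cell set \<Rightarrow> nat" where
  "polyomino_size P = width P + height P - 1"

definition topmost_row :: "cell set \<Rightarrow> cell set" where
  "topmost_row P = {c \<in> P. snd c = Max (snd ` P)}"

definition rightmost_column :: "cell set \<Rightarrow> cell set" where
  "rightmost_column P = {c \<in> P. fst c = Max (fst ` P)}"


section \<open>Slicings\<close>

text \<open>The cell remaining last is a block that is neither horizontal nor vertical.\<close>

datatype block = Single "cell set" | Horizontal "cell set" | Vertical "cell set"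

inductive baxter_slicing :: "nat \<Rightarrow> cell set \<Rightarrow> block set \<Rightarrow> bool" where
  single: "baxter_slicing 1 {(0, 0)} {Single {(0, 0)}}"
| horizontal:
    "\<lbrakk>parallelogram_polyomino P; polyomino_size P = Suc n; baxter_slicing n (P - topmost_row P) S\<rbrakk>
     \<Longrightarrow> baxter_slicing (Suc n) P (insert (Horizontal (topmost_row P)) S)"
| vertical:
    "\<lbrakk>parallelogram_polyomino P; polyomino_size P = Suc n; baxter_slicing n (P - rightmost_column P) S\<rbrakk>
     \<Longrightarrow> baxter_slicing (Suc n) P (insert (Vertical (rightmost_column P)) S)"

definition right_edge :: "cell set \<Rightarrow> nat" where
  "right_edge B = Suc (Max (fst ` B))"

definition X_point :: "cell set \<Rightarrow> cell set \<Rightarrow> point" where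
  "X_point P B =
     (right_edge B, LEAST y. (right_edge B, y) \<in> vertices (0, 0) (lower_border P))"

definition r_value :: "cell set \<Rightarrow> cell set \<Rightarrow> nat" where
  "r_value P B =
     east_run (THE v. prefix v (lower_border P) \<and> endpoint (0, 0) v = X_point P B)"

definition schroeder_slicing :: "nat \<Rightarrow> cell set \<Rightarrow> block set \<Rightarrow> bool" where
  "schroeder_slicing n P S \<longleftrightarrow>
     baxter_slicing n P S \<and> (\<forall>B. Horizontal B \<in> S \<longrightarrow> width B \<le> r_value P B + 1)"

definition schroeder_slicings :: "nat \<Rightarrow> (cell set \<times> block set) set" where
  "schroeder_slicings n = {(P, S). schroeder_slicing n P S}"


section \<open>Triples of non-intersecting lattice paths\<close>

definition nilp_triple :: "nat \<Rightarrow> path \<times> path \<times> path \<Rightarrow> bool" where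
  "nilp_triple n = (\<lambda>(u, m, d).
     Suc (length u) = n \<and> Suc (length m) = n \<and> Suc (length d) = n \<and>
     count_list u E = count_list m E \<and> count_list m E = count_list d E \<and>
     vertices (0, 2) u \<inter> vertices (1, 1) m = {} \<and>
     vertices (1, 1) m \<inter> vertices (2, 0) d = {} \<and>
     vertices (0, 2) u \<inter> vertices (2, 0) d = {})"

text \<open>Two \<open>s\<close> steps, identified by the parts of the paths before them, have the same rank among
  the \<open>s\<close> steps of their paths.\<close>

definition matched :: "step \<Rightarrow> path \<Rightarrow> path \<Rightarrow> bool" where
  "matched s v w \<longleftrightarrow> count_list v s = count_list w s"

definition last_step :: "step \<Rightarrow> path \<Rightarrow> path \<Rightarrow> bool" where
  "last_step s w v \<longleftrightarrow> is_step s w v \<and> (\<forall>v'. is_step s w v' \<longrightarrow> length v' \<le> length v)"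

text \<open>In the condition below, \<open>nu\<close>, \<open>nm\<close>, \<open>em\<close>, \<open>ed\<close> are the parts before the steps \<open>N\<^sub>u\<close>, \<open>N\<^sub>m\<close>,
  \<open>E\<^sub>m\<close>, \<open>E\<^sub>d\<close>, and \<open>h\<^sub>u(N\<^sub>u)\<close> and \<open>h\<^sub>m(N\<^sub>m)\<close> are \<open>count_list nu E\<close> and \<open>count_list nm E\<close>. Since \<open>u\<close>
  stays strictly to the left of \<open>m\<close>, matched \<open>N\<close> steps satisfy \<open>h\<^sub>u(N\<^sub>u) \<le> h\<^sub>m(N\<^sub>m)\<close>; the
  quantity to be bounded is thus \<open>h\<^sub>m(N\<^sub>m) - h\<^sub>u(N\<^sub>u)\<close>, the opposite difference never being
  positive. If \<open>N\<^sub>m\<close> is preceded by no \<open>E\<close> step then this quantity is \<open>0\<close>, and nothing is required.\<close>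

definition schroeder_triple :: "nat \<Rightarrow> path \<times> path \<times> path \<Rightarrow> bool" where
  "schroeder_triple n = (\<lambda>(u, m, d).
     nilp_triple n (u, m, d) \<and>
     (\<forall>nu nm em ed.
        is_step N u nu \<and> is_step N m nm \<and> matched N nu nm \<and>
        last_step E nm em \<and> is_step E d ed \<and> matched E em ed \<longrightarrow>
        int (count_list nm E) - int (count_list nu E) \<le> int (east_run (ed @ [E]))))"

definition schroeder_triples :: "nat \<Rightarrow> (path \<times> path \<times> path) set" where
  "schroeder_triples n = {t. schroeder_triple n t}"


section \<open>The map from slicings to triples of paths\<close>

text \<open>The path goes from \<open>(1,1)\<close> to the top-right corner of \<open>P\<close>.
  Inside \<open>P\<close> it runs along lower borders of horizontal blocks and left borders of vertical
  blocks: a cell of \<open>P\<close> directly above an \<open>E\<close> step (to the right of an \<open>N\<close> step) is in a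
  horizontal (vertical) block. An \<open>E\<close> step with no cell of \<open>P\<close> above it is on the upper border of
  \<open>P\<close>, an \<open>N\<close> step with no cell of \<open>P\<close> to its right on the lower border; such steps cannot be
  avoided (the block removed first has no block beyond it).
  Moreover every one of these block borders is reached: the path visits the right end of
  the lower border of each horizontal block and the upper end of the left border of each
  vertical block. These points leave no choice for the path.\<close>

definition follows_blocks :: "cell set \<Rightarrow> block set \<Rightarrow> path \<Rightarrow> bool" where
  "follows_blocks P S m \<longleftrightarrow>
     endpoint (1, 1) m = (Suc (Max (fst ` P)), Suc (Max (snd ` P))) \<and>
     (\<forall>c \<in> step_starts E (1, 1) m \<inter> P. \<exists>B. Horizontal B \<in> S \<and> c \<in> B) \<and>
     (\<forall>c \<in> step_starts N (1, 1) m \<inter> P. \<exists>B. Vertical B \<in> S \<and> c \<in> B) \<and>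
     (\<forall>B. Horizontal B \<in> S \<longrightarrow> (right_edge B, Min (snd ` B)) \<in> vertices (1, 1) m) \<and>
     (\<forall>B. Vertical B \<in> S \<longrightarrow> (Min (fst ` B), Suc (Max (snd ` B))) \<in> vertices (1, 1) m)"

definition middle_path :: "cell set \<Rightarrow> block set \<Rightarrow> path" where
  "middle_path P S = (THE m. follows_blocks P S m)"

text \<open>Paths are step words, hence the translations of the outer borders leave no trace.\<close>

definition slicing_to_triple :: "cell set \<times> block set \<Rightarrow> path \<times> path \<times> path" where
  "slicing_to_triple = (\<lambda>(P, S).
     (butlast (tl (upper_border P)), middle_path P S, butlast (tl (lower_border P))))"

end

theory Submission
  imports Defs
begin

text \<open>In terms of numbers of \<open>N\<close> steps in prefixes of equal length, three paths of equal type form a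
  non-intersecting triple if and only if \<open>d \<le> m \<le> u\<close> at every prefix. The last step of \<open>m\<close> tells
  which block of the slicing is removed first: if it is \<open>N\<close>, then \<open>d = d' N\<close> and \<open>u = v N E\<^sup>j\<close>, and
  removing the top row, of width \<open>j + 1\<close>, yields the triple \<open>(v E\<^sup>j, m', d')\<close>; the case \<open>E\<close> is its
  reflection in the diagonal. By induction, the blocks are exactly the rows and columns spanned by
  the matched steps of the triple. The row of the matched steps \<open>N\<^sub>u\<close>, \<open>N\<^sub>m\<close> has width
  \<open>h\<^sub>m(N\<^sub>m) - h\<^sub>u(N\<^sub>u) + 1\<close>, and the part of the lower border that arrives at its point \<open>X\<close> ends
  with the step \<open>E\<^sub>d\<close>, so that the two Schroeder conditions agree.\<close>

section \<open>Step counts along prefixes, and steps identified by their rank\<close>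

abbreviation norths :: "path \<Rightarrow> nat \<Rightarrow> nat" where
  "norths w k \<equiv> count_list (take k w) N"

abbreviation easts :: "path \<Rightarrow> nat \<Rightarrow> nat" where
  "easts w k \<equiv> count_list (take k w) E"

lemma count_N_E: "count_list w N + count_list w E = length w"
proof (induction w)
  case (Cons s w)
  then show ?case by (cases s) auto
qed simp

lemma norths_easts: "k \<le> length w \<Longrightarrow> norths w k + easts w k = k"
  using count_N_E[of "take k w"] by simp

lemma norths_le: "norths w k \<le> k"
  using count_N_E[of "take k w"] by simp

lemma norths_mono: "j \<le> k \<Longrightarrow> norths w j \<le> norths w k"
proof -
  assume "j \<le> k"
  then have "take k w = take j w @ take (k - j) (drop j w)"
    by (metis take_add le_add_diff_inverse)
  then show ?thesis by simp
qed

lemma easts_mono: "j \<le> k \<Longrightarrow> easts w j \<le> easts w k"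
proof -
  assume "j \<le> k"
  then have "take k w = take j w @ take (k - j) (drop j w)"
    by (metis take_add le_add_diff_inverse)
  then show ?thesis by simp
qed

lemma norths_le_total: "norths w k \<le> count_list w N"
  by (metis append_take_drop_id count_list_append le_add1)

lemma easts_le_total: "easts w k \<le> count_list w E"
  by (metis append_take_drop_id count_list_append le_add1)

lemma norths_Suc:
  "norths w (Suc k) = norths w k + (if k < length w \<and> w ! k = N then 1 else 0)"
  by (cases "k < length w") (simp_all add: take_Suc_conv_app_nth)

text \<open>With two letters, the step at position \<open>i\<close> is \<open>N\<close> exactly when
  the count of \<open>N\<close> grows there, so these counts determine the word.\<close>

lemma path_eqI:
  assumes "length v = length w" "\<And>k. k \<le> length v \<Longrightarrow> norths v k = norths w k"
  shows "v = w"
proof (rule nth_equalityI)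
  fix i assume i: "i < length v"
  then have "v ! i = N \<longleftrightarrow> w ! i = N"
    using assms(2)[of i] assms(2)[of "Suc i"] norths_Suc[of i v] norths_Suc[of i w] assms(1)
    by (auto split: if_splits)
  then show "v ! i = w ! i" by (metis step.exhaust)
qed (rule assms(1))

lemma prefix_iff_take: "prefix v w \<longleftrightarrow> (\<exists>k\<le>length w. v = take k w)"
  by (metis append_eq_conv_conj prefix_def prefix_length_le take_is_prefix)

lemma vertices_eq:
  "vertices (x, y) w = {(x + easts w k, y + norths w k) | k. k \<le> length w}"
  by (auto simp: vertices_def endpoint_def prefix_iff_take)

lemma is_step_iff: "is_step s w v \<longleftrightarrow> (\<exists>k<length w. v = take k w \<and> w ! k = s)"
proof
  assume "is_step s w v"
  then obtain t where "w = v @ s # t" by (auto simp: is_step_def prefix_def)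
  then show "\<exists>k<length w. v = take k w \<and> w ! k = s"
    by (intro exI[of _ "length v"]) auto
next
  assume "\<exists>k<length w. v = take k w \<and> w ! k = s"
  then show "is_step s w v"
    by (metis is_step_def take_Suc_conv_app_nth take_is_prefix)
qed

lemma is_step_append:
  "is_step s (v @ w) x \<longleftrightarrow> is_step s v x \<or> (\<exists>y. x = v @ y \<and> is_step s w y)"
proof
  assume "is_step s (v @ w) x"
  then obtain k where k: "k < length (v @ w)" "x = take k (v @ w)" "(v @ w) ! k = s"
    by (auto simp: is_step_iff)
  show "is_step s v x \<or> (\<exists>y. x = v @ y \<and> is_step s w y)"
  proof (cases "k < length v")
    case True
    then show ?thesis using k by (auto simp: is_step_iff nth_append)
  next
    case False
    then have "x = v @ take (k - length v) w" "k - length v < length w" "w ! (k - length v) = s"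
      using k by (auto simp: nth_append)
    then show ?thesis by (auto simp: is_step_iff)
  qed
next
  assume "is_step s v x \<or> (\<exists>y. x = v @ y \<and> is_step s w y)"
  then show "is_step s (v @ w) x"
    by (auto simp: is_step_def prefix_def)
qed

lemma is_step_single: "is_step s [t] x \<longleftrightarrow> x = [] \<and> s = t"
  by (auto simp: is_step_iff)

lemma is_step_Cons:
  "is_step s (t # w) x \<longleftrightarrow> (x = [] \<and> s = t) \<or> (\<exists>y. x = t # y \<and> is_step s w y)"
  using is_step_append[of s "[t]" w x] by (auto simp: is_step_single)

lemma is_step_replicate: "s \<noteq> t \<Longrightarrow> \<not> is_step s (replicate k t) x"
  by (auto simp: is_step_iff)

lemma is_step_count_less: "is_step s w v \<Longrightarrow> count_list v s < count_list w s"
  by (auto simp: is_step_def prefix_def)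

text \<open>Source of all matched steps: equal totals on two paths make every rank that occurs on
  one occur on the other.\<close>

lemma is_step_at_rank:
  assumes "i < count_list w s"
  obtains v where "is_step s w v" "count_list v s = i"
  using assms
proof (induction w arbitrary: i thesis)
  case (Cons t w)
  show ?case
  proof (cases "s = t \<and> i = 0")
    case True
    then show ?thesis using Cons.prems(1)[of "[]"] by (auto simp: is_step_Cons)
  next
    case False
    then have "(if s = t then i - 1 else i) < count_list w s"
      using Cons.prems(2) by (auto split: if_splits)
    from Cons.IH[OF _ this] obtain v where
      "is_step s w v" "count_list v s = (if s = t then i - 1 else i)" by blast
    then show ?thesis using Cons.prems(1)[of "t # v"] False
      by (auto simp: is_step_Cons split: if_splits)
  qed
qed simp


section \<open>Paths lying above each other\<close>

text \<open>Past the end of the paths the counts are the totals, which agree for equal lengths and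
  equal numbers of \<open>E\<close> steps; hence \<open>k\<close> may range over all
  naturals.\<close>

definition above :: "path \<Rightarrow> path \<Rightarrow> bool" where
  "above u d \<longleftrightarrow> length u = length d \<and> count_list u E = count_list d E \<and>
     (\<forall>k. norths d k \<le> norths u k)"

lemma above_length: "above u d \<Longrightarrow> length u = length d"
  and above_count: "above u d \<Longrightarrow> count_list u s = count_list d s"
  and above_norths: "above u d \<Longrightarrow> norths d k \<le> norths u k"
  using count_N_E[of u] count_N_E[of d] by (cases s; auto simp: above_def)+

lemma above_trans: "above u m \<Longrightarrow> above m d \<Longrightarrow> above u d"
  unfolding above_def by (metis order_trans)

text \<open>A discrete intermediate value argument: the difference of the two counts starts at 0 and
  grows by at most 1 per step, so it cannot become positive without being exactly 1.\<close>

lemma no_crossing: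
  assumes "\<And>k. k \<le> K \<Longrightarrow> norths d k \<noteq> Suc (norths u k)" "k \<le> K"
  shows "norths d k \<le> norths u k"
  using assms(2)
proof (induction k)
  case (Suc k)
  then show ?case
    using assms(1)[of "Suc k"] norths_Suc[of k d] norths_Suc[of k u] by (auto split: if_splits)
qed simp

text \<open>Both starting points lie on the same antidiagonal, so a common point is reached after
  the same number of steps on both paths. There, meeting means that \<open>m\<close> has compensated
  its lower start by one additional \<open>N\<close> step.\<close>

lemma vertices_disjoint_iff:
  assumes "length u = length m"
  shows "vertices (x, Suc y) u \<inter> vertices (Suc x, y) m = {} \<longleftrightarrow>
         (\<forall>k\<le>length u. norths m k \<noteq> Suc (norths u k))"
proof
  assume "vertices (x, Suc y) u \<inter> vertices (Suc x, y) m = {}"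
  moreover have False if "vertices (x, Suc y) u \<inter> vertices (Suc x, y) m = {}"
    "k \<le> length u" "norths m k = Suc (norths u k)" for k
  proof -
    have "easts u k = Suc (easts m k)"
      using that(2,3) norths_easts[of k u] norths_easts[of k m] assms by linarith
    then have "(x + easts u k, Suc y + norths u k) \<in> vertices (x, Suc y) u \<inter> vertices (Suc x, y) m"
      using that(2,3) assms by (auto simp: vertices_eq intro!: exI[of _ k])
    then show False using that(1) by blast
  qed
  ultimately show "\<forall>k\<le>length u. norths m k \<noteq> Suc (norths u k)" by blast
next
  assume *: "\<forall>k\<le>length u. norths m k \<noteq> Suc (norths u k)"
  show "vertices (x, Suc y) u \<inter> vertices (Suc x, y) m = {}"
  proof (rule ccontr)
    assume "vertices (x, Suc y) u \<inter> vertices (Suc x, y) m \<noteq> {}"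
    then obtain k l where kl: "k \<le> length u" "l \<le> length m" "x + easts u k = Suc x + easts m l"
      "Suc y + norths u k = y + norths m l" by (auto simp: vertices_eq)
    then have "k = l" using norths_easts[of k u] norths_easts[of l m] by linarith
    then show False using kl * by auto
  qed
qed

lemma nilp_triple_iff:
  "nilp_triple n (u, m, d) \<longleftrightarrow> Suc (length u) = n \<and> above u m \<and> above m d"
proof
  assume "nilp_triple n (u, m, d)"
  then have n: "Suc (length u) = n" "length u = length m" "length m = length d"
    "count_list u E = count_list m E" "count_list m E = count_list d E"
    \<comment> \<open>The starting points are written with \<open>Suc\<close> to fit the common form
      of \<open>vertices_disjoint_iff\<close>, for the corners \<open>(0, 1)\<close> and
      \<open>(1, 0)\<close>.\<close>
    "vertices (0, Suc 1) u \<inter> vertices (Suc 0, 1) m = {}"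
    "vertices (1, Suc 0) m \<inter> vertices (Suc 1, 0) d = {}"
    unfolding nilp_triple_def by (auto simp: numeral_2_eq_2)
  have above: "above a b" if "length a = length b" "count_list a E = count_list b E"
    "\<forall>k\<le>length a. norths b k \<noteq> Suc (norths a k)" for a b
  proof -
    have "norths b k \<le> norths a k" for k
    proof (cases "k \<le> length a")
      case True
      then show ?thesis using no_crossing[of "length a"] that(3) by blast
    next
      case False
      then show ?thesis using that(1,2) count_N_E[of a] count_N_E[of b] by simp
    qed
    then show ?thesis using that by (auto simp: above_def)
  qed
  show "Suc (length u) = n \<and> above u m \<and> above m d"
    using n above vertices_disjoint_iff[OF n(2)] vertices_disjoint_iff[OF n(3)] by blast
next
  assume *: "Suc (length u) = n \<and> above u m \<and> above m d"
  have "norths m k \<noteq> Suc (norths u k)" "norths d k \<noteq> Suc (norths m k)" for k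
    using * by (metis above_norths not_less_eq_eq order_refl)+
  then have "vertices (0, 2) u \<inter> vertices (1, 1) m = {}" "vertices (1, 1) m \<inter> vertices (2, 0) d = {}"
    using * vertices_disjoint_iff[of u m 0 1] vertices_disjoint_iff[of m d 1 0]
    by (simp_all add: above_length numeral_2_eq_2)
  \<comment> \<open>A common point of the outer paths would give \<open>d\<close> two more
    \<open>N\<close> steps than \<open>u\<close> at the same length, against
    \<open>above u d\<close>.\<close>
  moreover have "vertices (0, 2) u \<inter> vertices (2, 0) d = {}"
  proof (rule ccontr)
    assume "vertices (0, 2) u \<inter> vertices (2, 0) d \<noteq> {}"
    then obtain k l where kl: "k \<le> length u" "l \<le> length d" "easts u k = 2 + easts d l"
      "2 + norths u k = norths d l" by (auto simp: vertices_eq)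
    then have "k = l" using norths_easts[of k u] norths_easts[of l d] by linarith
    then show False using kl * above_norths[OF above_trans, of u m d k] by auto
  qed
  ultimately show "nilp_triple n (u, m, d)"
    using * by (auto simp: nilp_triple_def above_def)
qed


section \<open>The region between two paths\<close>

text \<open>A cell \<open>(x, y)\<close> lies between the borders \<open>N u E\<close> and \<open>E d N\<close> if and only if its
  antidiagonal, from \<open>(x, y + 1)\<close> to \<open>(x + 1, y)\<close>, lies between the points that the borders
  reach after \<open>x + y + 1\<close> steps. Unlike the description by columns, this one is symmetric
  under reflection in the diagonal.\<close>

definition region :: "path \<Rightarrow> path \<Rightarrow> cell set" where
  "region u d = {(x, y). x + y \<le> length u \<and> norths d (x + y) \<le> y \<and> y \<le> norths u (x + y)}"

lemma region_bounds:
  assumes "above u d" "(x, y) \<in> region u d"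
  shows "x \<le> count_list u E" "y \<le> count_list u N"
proof -
  have "x \<le> easts d (x + y)"
    using assms norths_easts[of "x + y" d] by (auto simp: region_def above_length)
  then show "x \<le> count_list u E"
    using easts_le_total[of "x + y" d] above_count[OF assms(1), of E] by simp
  show "y \<le> count_list u N"
    using assms norths_le_total[of "x + y" u] by (auto simp: region_def)
qed

lemma finite_region: "finite (region u d)"
  by (rule finite_subset[of _ "{..length u} \<times> {..length u}"]) (auto simp: region_def)

lemma origin_in_region: "(0, 0) \<in> region u d"
  by (simp add: region_def)

lemma corner_in_region: "above u d \<Longrightarrow> (count_list u E, count_list u N) \<in> region u d"
  using count_N_E[of u] norths_le_total[of _ d] above_count[of u d N]
  by (simp add: region_def add.commute)

lemma region_extent:
  assumes "above u d"
  shows "Max (fst ` region u d) = count_list u E" "Min (fst ` region u d) = 0"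
    "Max (snd ` region u d) = count_list u N" "Min (snd ` region u d) = 0"
proof -
  note fin = finite_imageI[OF finite_region]
  show "Max (fst ` region u d) = count_list u E" "Max (snd ` region u d) = count_list u N"
    using region_bounds[OF assms] corner_in_region[OF assms]
    by (auto intro!: Max_eqI fin simp: image_iff Bex_def)
  show "Min (fst ` region u d) = 0" "Min (snd ` region u d) = 0"
    using origin_in_region[of u d] by (auto intro!: Min_eqI fin simp: image_iff Bex_def)
qed

lemma polyomino_size_region: "above u d \<Longrightarrow> polyomino_size (region u d) = Suc (length u)"
  using count_N_E[of u] by (simp add: polyomino_size_def width_def height_def region_extent)

text \<open>On each antidiagonal the cells form a nonempty interval of ordinates whose ends are the
  two counts, so the region determines both paths. Their length comes from the size of the
  polyomino.\<close>

lemma region_inject: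
  assumes "above u d" "above u' d'" "region u d = region u' d'"
  shows "u = u' \<and> d = d'"
proof -
  have len: "length u = length u'"
    using assms polyomino_size_region by (metis Suc_inject)
  have eq: "norths d k = norths d' k \<and> norths u k = norths u' k" if "k \<le> length u" for k
  proof -
    have *: "norths b k \<le> y \<and> y \<le> norths a k \<longleftrightarrow> y \<le> k \<and> (k - y, y) \<in> region a b"
      if "k \<le> length a" for a b y
      using norths_le[of k a] that by (auto simp: region_def)
    have "norths d k \<le> y \<and> y \<le> norths u k \<longleftrightarrow> norths d' k \<le> y \<and> y \<le> norths u' k" for y
      unfolding *[OF that] *[OF that[unfolded len]] assms(3) ..
    then show ?thesis
      using above_norths[OF assms(1), of k] above_norths[OF assms(2), of k]
      by (metis le_antisym order_refl)
  qed
  then show ?thesis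
    using len assms by (auto intro!: path_eqI simp: above_length)
qed

text \<open>Every cell other than the origin has a left or lower neighbour in the region, on the
  preceding antidiagonal. Hence all cells are linked to the origin, and by symmetry to each
  other.\<close>

lemma edge_connected_region:
  assumes "above u d"
  shows "edge_connected (region u d)"
proof -
  let ?R = "{(c, c'). c \<in> region u d \<and> c' \<in> region u d \<and> adjacent c c'}"
  have sym: "sym (?R\<^sup>*)"
    by (rule sym_rtrancl) (auto simp: sym_def adjacent_def)
  have "((0, 0), (x, y)) \<in> ?R\<^sup>*" if "(x, y) \<in> region u d" for x y
    using that
  proof (induction "x + y" arbitrary: x y)
    case (Suc k)
    have xy: "Suc k \<le> length u" "norths d (Suc k) \<le> y" "y \<le> norths u (Suc k)"
      using Suc.prems Suc.hyps(2) by (simp_all add: region_def)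
    have nd: "norths d k \<le> y"
      using norths_mono[of k "Suc k" d] xy by simp
    obtain c where c: "c \<in> region u d" "fst c + snd c = k" "adjacent c (x, y)"
    \<comment> \<open>The left neighbour has the same ordinate and fits if the upper border is
      already that high. Otherwise the border has just made an \<open>N\<close> step and the cell is
      the topmost of its antidiagonal, so the lower neighbour fits.\<close>
    proof (cases "y \<le> norths u k")
      case True
      then have "x \<noteq> 0" using Suc.hyps(2) norths_le[of k u] by auto
      then have "x - 1 + y = k" using Suc.hyps(2) by simp
      with \<open>x \<noteq> 0\<close> have "(x - 1, y) \<in> region u d" "fst (x - 1, y) + snd (x - 1, y) = k"
        "adjacent (x - 1, y) (x, y)"
        using True xy nd Suc.hyps(2) by (auto simp: region_def adjacent_def)
      then show ?thesis using that by blast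
    next
      case False
      then have y: "y = Suc (norths u k)"
        using xy norths_Suc[of k u] by (auto split: if_splits)
      then have "(x, y - 1) \<in> region u d" "fst (x, y - 1) + snd (x, y - 1) = k"
        "adjacent (x, y - 1) (x, y)"
        using xy nd above_norths[OF assms, of k] Suc.hyps(2)
        by (auto simp: region_def adjacent_def)
      then show ?thesis using that by blast
    qed
    then have "((0, 0), c) \<in> ?R\<^sup>*" using Suc.hyps(1)[of "fst c" "snd c"] by simp
    moreover have "(c, (x, y)) \<in> ?R" using c Suc.prems by simp
    ultimately show ?case by (rule rtrancl_into_rtrancl)
  qed simp
  then show ?thesis
    unfolding edge_connected_def using sym
    by (metis (no_types, lifting) rtrancl_trans surj_pair symD)
qed

section \<open>From the description by columns to the one by antidiagonals\<close>

lemma is_step_take: "is_step s (take k w) v \<longleftrightarrow> is_step s w v \<and> length v < k"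
  by (auto simp: is_step_iff)

lemma is_step_take_length: "is_step s w v \<Longrightarrow> take (length v) w = v"
  by (auto simp: is_step_iff)

text \<open>The \<open>E\<close> step above abscissa \<open>x\<close> has \<open>x\<close> earlier
  \<open>E\<close> steps. Its height is at most \<open>y\<close> if and only if at most
  \<open>x + y\<close> steps precede it, that is, if it is among the first \<open>x + y + 1\<close>
  steps.\<close>

lemma E_step_at_most_iff:
  "(\<exists>a\<le>y. (x, a) \<in> step_starts E (0, 0) w) \<longleftrightarrow> x < easts w (Suc (x + y))"
proof
  assume "\<exists>a\<le>y. (x, a) \<in> step_starts E (0, 0) w"
  then obtain v where v: "is_step E w v" "count_list v E = x" "count_list v N \<le> y"
    by (auto simp: step_starts_def endpoint_def)
  then have "is_step E (take (Suc (x + y)) w) v"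
    using count_N_E[of v] by (simp add: is_step_take)
  then show "x < easts w (Suc (x + y))"
    using is_step_count_less v(2) by blast
next
  assume "x < easts w (Suc (x + y))"
  then obtain v where "is_step E (take (Suc (x + y)) w) v" "count_list v E = x"
    by (rule is_step_at_rank)
  then show "\<exists>a\<le>y. (x, a) \<in> step_starts E (0, 0) w"
    using count_N_E[of v]
    by (auto simp: step_starts_def endpoint_def is_step_take intro!: exI[of _ "count_list v N"])
qed

text \<open>The complementary count, together with the existence of an \<open>E\<close> step above
  abscissa \<open>x\<close>.\<close>

lemma E_step_above_iff:
  "(\<exists>b>y. (x, b) \<in> step_starts E (0, 0) w) \<longleftrightarrow>
     x < count_list w E \<and> easts w (Suc (x + y)) \<le> x"
proof
  assume "\<exists>b>y. (x, b) \<in> step_starts E (0, 0) w"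
  then obtain v where v: "is_step E w v" "count_list v E = x" "count_list v N > y"
    by (auto simp: step_starts_def endpoint_def)
  then have "easts w (Suc (x + y)) \<le> easts w (length v)"
    using count_N_E[of v] by (intro easts_mono) simp
  then show "x < count_list w E \<and> easts w (Suc (x + y)) \<le> x"
    using v is_step_count_less[OF v(1)] by (simp add: is_step_take_length)
next
  assume *: "x < count_list w E \<and> easts w (Suc (x + y)) \<le> x"
  then obtain v where v: "is_step E w v" "count_list v E = x"
    using is_step_at_rank by blast
  have "count_list v N > y"
  proof (rule ccontr)
    assume "\<not> count_list v N > y"
    then have "is_step E (take (Suc (x + y)) w) v"
      using v count_N_E[of v] by (simp add: is_step_take)
    then show False using is_step_count_less v(2) * by fastforce
  qed
  then show "\<exists>b>y. (x, b) \<in> step_starts E (0, 0) w"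
    using v by (auto simp: step_starts_def endpoint_def)
qed

lemma region_eq_columns:
  assumes "above u d"
  shows "region u d = {(x, y). \<exists>a b. (x, a) \<in> step_starts E (0, 0) (E # d @ [N]) \<and>
    (x, b) \<in> step_starts E (0, 0) (N # u @ [E]) \<and> a \<le> y \<and> y < b}" (is "_ = ?R")
proof -
  have "(x, y) \<in> region u d \<longleftrightarrow> (x, y) \<in> ?R" for x y
  proof -
    let ?k = "x + y"
    have "(x, y) \<in> ?R \<longleftrightarrow> (\<exists>a\<le>y. (x, a) \<in> step_starts E (0, 0) (E # d @ [N])) \<and>
        (\<exists>b>y. (x, b) \<in> step_starts E (0, 0) (N # u @ [E]))" by blast
    \<comment> \<open>The initial \<open>E\<close> of the lower border turns the strict inequality
      into a weak one. The final \<open>E\<close> of the upper border is counted only when the first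
      \<open>?k\<close> steps after its initial \<open>N\<close> go beyond \<open>u\<close>.\<close>
    also have "\<dots> \<longleftrightarrow> x \<le> easts d ?k \<and> x \<le> count_list u E \<and>
        easts u ?k + (if ?k \<le> length u then 0 else 1) \<le> x"
      unfolding E_step_at_most_iff E_step_above_iff by (auto simp: take_Cons')
    also have "\<dots> \<longleftrightarrow> (x, y) \<in> region u d"
    proof (cases "?k \<le> length u")
      case True
      then show ?thesis
        using norths_easts[of ?k u] norths_easts[of ?k d] above_length[OF assms]
          above_count[OF assms, of E] easts_le_total[of ?k d]
        by (auto simp: region_def)
    qed (auto simp: region_def)
    finally show ?thesis by simp
  qed
  then show ?thesis by auto
qed

text \<open>The borders meet only at their ends, so after the forced first steps they cannot cross
  before their last step. The common endpoint then forces the last steps, and what remains is a pair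
  ordered by \<open>above\<close>.\<close>

lemma bounded_by_iff:
  "bounded_by P U D \<longleftrightarrow>
     (\<exists>u d. U = N # u @ [E] \<and> D = E # d @ [N] \<and> above u d \<and> P = region u d)"
proof
  assume b: "bounded_by P U D"
  obtain U' D' where UD: "U = N # U'" "D = E # D'"
    using b by (auto simp: bounded_by_def prefix_def)
  have "endpoint (0, 0) U = endpoint (0, 0) D"
    and disjoint: "vertices (0, 0) U \<inter> vertices (0, 0) D = {(0, 0), endpoint (0, 0) U}"
    using b by (auto simp: bounded_by_def)
  then have counts: "count_list U' E = Suc (count_list D' E)" "Suc (count_list U' N) = count_list D' N"
    by (auto simp: UD endpoint_def)
  then have len: "length U' = length D'"
    using count_N_E[of U'] count_N_E[of D'] by simp
  obtain L where L: "length U' = Suc L"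
    using counts by (cases U') auto
  \<comment> \<open>Equality would make the two borders meet after \<open>Suc j\<close> steps. This
    point is not the origin, having positive ordinate, and not the endpoint, since
    \<open>j \<le> L\<close> leaves at least one step to make.\<close>
  have "norths D' j \<noteq> Suc (norths U' j)" if "j \<le> L" for j
  proof
    assume eq: "norths D' j = Suc (norths U' j)"
    have j: "norths U' j + easts U' j = j" "norths D' j + easts D' j = j"
      using that L len by (auto intro!: norths_easts)
    have "(easts U' j, Suc (norths U' j)) \<in> vertices (0, 0) U"
      using that L by (auto simp: UD vertices_eq intro!: exI[of _ "Suc j"])
    moreover have "(easts U' j, Suc (norths U' j)) \<in> vertices (0, 0) D"
      using that L len j eq by (auto simp: UD vertices_eq intro!: exI[of _ "Suc j"])
    ultimately have "(easts U' j, Suc (norths U' j)) = endpoint (0, 0) U"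
      using disjoint by auto
    then have "j = length U'"
      using j(1) count_N_E[of U'] by (simp add: UD endpoint_def)
    then show False using that L by simp
  qed
  then have le: "norths D' j \<le> norths U' j" if "j \<le> L" for j
    using no_crossing[of L] that by blast
  have L': "length D' = Suc L" using L len by simp
  have "count_list w N = norths w L + (if w ! L = N then 1 else 0)" if "length w = Suc L" for w
    using norths_Suc[of L w] that by simp
  note this[OF L] this[OF L']
  \<comment> \<open>In total \<open>D'\<close> has one more \<open>N\<close> than \<open>U'\<close>,
    but no more than \<open>U'\<close> among the first \<open>L\<close> steps; only the last steps
    can make the difference.\<close>
  then have "norths D' L + (if D' ! L = N then 1 else 0) =
      Suc (norths U' L + (if U' ! L = N then 1 else 0))"
    using counts(2) by linarith
  then have last: "U' ! L = E" "D' ! L = N"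
    using le[of L] by (cases "U' ! L"; cases "D' ! L"; simp)+
  define u d where "u = take L U'" and "d = take L D'"
  have ud: "U' = u @ [E]" "D' = d @ [N]"
    using last L len take_Suc_conv_app_nth[of L U'] take_Suc_conv_app_nth[of L D']
    by (simp_all add: u_def d_def)
  have "above u d"
    unfolding above_def
  proof (intro conjI allI)
    show "norths d k \<le> norths u k" for k
      using le[of "min k L"] by (simp add: u_def d_def min.commute)
  qed (use counts len in \<open>auto simp: ud\<close>)
  moreover from this have "P = region u d"
    using b by (simp add: region_eq_columns bounded_by_def UD ud)
  ultimately show "\<exists>u d. U = N # u @ [E] \<and> D = E # d @ [N] \<and> above u d \<and> P = region u d"
    using UD ud by auto
next
  assume "\<exists>u d. U = N # u @ [E] \<and> D = E # d @ [N] \<and> above u d \<and> P = region u d"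
  then obtain u d where ud: "U = N # u @ [E]" "D = E # d @ [N]" "above u d" "P = region u d"
    by blast
  note len = above_length[OF ud(3)]
  have end_eq: "endpoint (0, 0) U = endpoint (0, 0) D"
    using above_count[OF ud(3)] by (auto simp: ud(1,2) endpoint_def)
  have "p = (0, 0) \<or> p = endpoint (0, 0) U"
    if p: "p \<in> vertices (0, 0) U \<inter> vertices (0, 0) D" for p
  proof -
    obtain k where k: "k \<le> length U" "p = (easts U k, norths U k)"
      using p by (auto simp: vertices_eq)
    obtain l where l: "l \<le> length D" "p = (easts D l, norths D l)"
      using p by (auto simp: vertices_eq)
    have kl: "k = l"
      using k l norths_easts[of k U] norths_easts[of l D] by auto
    consider "k = 0" | "k = length U" | j where "k = Suc j" "j \<le> length u"
      using k(1) by (cases k) (auto simp: ud le_Suc_eq)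
    then show ?thesis
    proof cases
      case 3
      then have "norths U k = Suc (norths u j)" "norths D k = norths d j"
        using len by (simp_all add: ud)
      then show ?thesis using above_norths[OF ud(3), of j] k l kl by simp
    qed (use k in \<open>auto simp: endpoint_def\<close>)
  qed
  moreover have "(0, 0) \<in> vertices (0, 0) w" "endpoint (0, 0) w \<in> vertices (0, 0) w" for w
    unfolding vertices_def by (auto simp: endpoint_def intro: exI[of _ "[]"])
  ultimately have "vertices (0, 0) U \<inter> vertices (0, 0) D = {(0, 0), endpoint (0, 0) U}"
    using end_eq by fastforce
  then show "bounded_by P U D"
    using end_eq region_eq_columns[OF ud(3)] by (simp add: bounded_by_def ud)
qed

lemma parallelogram_polyomino_iff:
  "parallelogram_polyomino P \<longleftrightarrow> (\<exists>u d. above u d \<and> P = region u d)"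
  by (auto simp: parallelogram_polyomino_def bounded_by_iff edge_connected_region)

lemma borders_region:
  assumes "above u d"
  shows "upper_border (region u d) = N # u @ [E]" "lower_border (region u d) = E # d @ [N]"
proof -
  have "bounded_by (region u d) U D \<longleftrightarrow> U = N # u @ [E] \<and> D = E # d @ [N]" for U D
    using assms region_inject[OF assms] unfolding bounded_by_iff by metis
  then show "upper_border (region u d) = N # u @ [E]" "lower_border (region u d) = E # d @ [N]"
    by (simp_all add: upper_border_def lower_border_def)
qed


section \<open>Reflection in the diagonal\<close>

fun flip_step :: "step \<Rightarrow> step" where
  "flip_step N = E"
| "flip_step E = N"

abbreviation flip :: "path \<Rightarrow> path" where
  "flip \<equiv> map flip_step"

lemma flip_step_flip_step [simp]: "flip_step (flip_step s) = s"
  by (cases s) auto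

lemma flip_step_comp [simp]: "flip_step \<circ> flip_step = id"
  by auto

lemma count_flip [simp]: "count_list (flip w) (flip_step s) = count_list w s"
  by (induction w) (auto, (metis flip_step_flip_step)+)

lemma count_flip_N [simp]: "count_list (flip w) N = count_list w E"
  and count_flip_E [simp]: "count_list (flip w) E = count_list w N"
  using count_flip[of w E] count_flip[of w N] by simp_all

text \<open>At equal lengths the \<open>E\<close> counts are complementary to the \<open>N\<close>
  counts, so exchanging the letters reverses the order.\<close>

lemma above_flip [simp]: "above (flip u) (flip d) \<longleftrightarrow> above d u"
proof -
  have *: "above (flip u) (flip d)" if "above d u" for u d
  proof -
    have "easts d k \<le> easts u k" for k
    proof (cases "k \<le> length d")
      case True
      then show ?thesis
        using that norths_easts[of k u] norths_easts[of k d] above_norths[OF that, of k]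
        by (simp add: above_length)
    qed (use that in \<open>simp add: above_def\<close>)
    then show ?thesis
      using that above_count[OF that, of N] by (simp add: above_def take_map)
  qed
  show ?thesis using *[of d u] *[of "flip u" "flip d"] by auto
qed

lemma nilp_triple_flip:
  "nilp_triple n (u, m, d) \<Longrightarrow> nilp_triple n (flip d, flip m, flip u)"
  using above_length[of u m] above_length[of m d] by (auto simp: nilp_triple_iff)

lemma region_flip:
  assumes "above u d"
  shows "region (flip d) (flip u) = prod.swap ` region u d"
proof -
  have "(x, y) \<in> region (flip d) (flip u) \<longleftrightarrow> (y, x) \<in> region u d" for x y
    using norths_easts[of "x + y" u] norths_easts[of "x + y" d] above_length[OF assms]
    by (auto simp: region_def take_map add.commute)
  then show ?thesis by auto
qed

lemma parallelogram_polyomino_swap: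
  "parallelogram_polyomino P \<Longrightarrow> parallelogram_polyomino (prod.swap ` P)"
  unfolding parallelogram_polyomino_iff
  by (elim exE conjE) (metis region_flip above_flip)

lemma polyomino_size_swap: "polyomino_size (prod.swap ` P) = polyomino_size P"
  by (simp add: polyomino_size_def width_def height_def image_image add.commute)

lemma topmost_row_swap: "topmost_row (prod.swap ` P) = prod.swap ` rightmost_column P"
  by (auto simp: topmost_row_def rightmost_column_def image_image)

lemma swap_swap_image: "prod.swap ` prod.swap ` A = A"
  by (simp add: image_image)

section \<open>Adding and removing blocks\<close>

text \<open>The horizontal block of row \<open>i + 1\<close> begins at the \<open>i\<close>-th \<open>N\<close> step of \<open>u\<close> and its bottom
  ends at the \<open>i\<close>-th \<open>N\<close> step of \<open>m\<close>; dually for columns, with the \<open>E\<close> steps of \<open>m\<close> and \<open>d\<close>.\<close>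

definition blocks :: "path \<Rightarrow> path \<Rightarrow> path \<Rightarrow> block set" where
  "blocks u m d = insert (Single {(0, 0)})
     ({Horizontal ({count_list nu E..count_list nm E} \<times> {Suc (count_list nm N)}) | nu nm.
         is_step N u nu \<and> is_step N m nm \<and> matched N nu nm} \<union>
      {Vertical ({Suc (count_list em E)} \<times> {count_list ed N..count_list em N}) | em ed.
         is_step E m em \<and> is_step E d ed \<and> matched E em ed})"

fun flip_block :: "block \<Rightarrow> block" where
  "flip_block (Single A) = Single (prod.swap ` A)"
| "flip_block (Horizontal A) = Vertical (prod.swap ` A)"
| "flip_block (Vertical A) = Horizontal (prod.swap ` A)"

lemma flip_block_flip_block: "flip_block (flip_block b) = b"
  by (cases b) (simp_all add: swap_swap_image)

lemma is_step_flip: "is_step s w v \<Longrightarrow> is_step (flip_step s) (flip w) (flip v)"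
  by (auto simp: is_step_def prefix_def)

text \<open>Reflection turns rows into columns and exchanges the roles of the outer paths, so every
  statement about horizontal blocks yields its vertical counterpart.\<close>

lemma blocks_flip: "blocks (flip d) (flip m) (flip u) = flip_block ` blocks u m d"
proof -
  have swap: "prod.swap ` (A \<times> B) = B \<times> A" for A B :: "nat set"
    by auto
  have *: "flip_block ` blocks u m d \<subseteq> blocks (flip d) (flip m) (flip u)" for u m d
  proof
    fix b assume "b \<in> flip_block ` blocks u m d"
    then obtain c where c: "b = flip_block c" "c \<in> blocks u m d" by blast
    then consider "c = Single {(0, 0)}"
      | nu nm where "c = Horizontal ({count_list nu E..count_list nm E} \<times> {Suc (count_list nm N)})"
          "is_step N u nu" "is_step N m nm" "matched N nu nm"
      | em ed where "c = Vertical ({Suc (count_list em E)} \<times> {count_list ed N..count_list em N})"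
          "is_step E m em" "is_step E d ed" "matched E em ed"
      by (auto simp: blocks_def)
    then show "b \<in> blocks (flip d) (flip m) (flip u)"
    proof cases
      case 2
      then have "b = Vertical ({Suc (count_list (flip nm) E)} \<times>
          {count_list (flip nu) N..count_list (flip nm) N})"
        "is_step E (flip m) (flip nm)" "is_step E (flip u) (flip nu)"
        "matched E (flip nm) (flip nu)"
        using c(1) is_step_flip[OF 2(2)] is_step_flip[OF 2(3)] by (auto simp: swap matched_def)
      then show ?thesis unfolding blocks_def by blast
    next
      case 3
      then have "b = Horizontal ({count_list (flip ed) E..count_list (flip em) E} \<times>
          {Suc (count_list (flip em) N)})"
        "is_step N (flip d) (flip ed)" "is_step N (flip m) (flip em)"
        "matched N (flip ed) (flip em)"
        using c(1) is_step_flip[OF 3(2)] is_step_flip[OF 3(3)] by (auto simp: swap matched_def)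
      then show ?thesis unfolding blocks_def by blast
    qed (simp add: c blocks_def)
  qed
  \<comment> \<open>The reverse inclusion is the inclusion already proved, applied to the flipped
    paths, because reflection is an involution.\<close>
  have "blocks (flip d) (flip m) (flip u) =
      flip_block ` flip_block ` blocks (flip d) (flip m) (flip u)"
    by (simp add: image_image flip_block_flip_block)
  also have "\<dots> \<subseteq> flip_block ` blocks u m d"
    using *[of "flip d" "flip m" "flip u"] by (intro image_mono) simp
  finally show ?thesis using * by blast
qed

section \<open>Inserting a last \<open>N\<close> step and the corresponding top row\<close>

lemma count_list_replicate [simp]: "count_list (replicate j s) t = (if s = t then j else 0)"
  by (induction j) auto

lemma norths_append_replicate_E: "norths (v @ replicate j E) k = norths v k"
  by (simp add: take_replicate)

lemma norths_insert_N:
  "norths (v @ N # replicate j E) k = norths v k + (if k \<le> length v then 0 else 1)"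
  by (cases "k - length v") (auto simp: take_replicate)

lemma norths_snoc_N: "norths (d @ [N]) k = norths d k + (if k \<le> length d then 0 else 1)"
  using norths_insert_N[of k d 0] by simp

text \<open>Up to the length of \<open>v\<close> no count changes. Beyond it, \<open>v\<close> has
  made all its \<open>N\<close> steps, which are as many as those of \<open>m\<close>, so the
  comparison holds with and without the added steps.\<close>

lemma above_insert_N:
  "above (v @ N # replicate j E) (m @ [N]) \<longleftrightarrow> above (v @ replicate j E) m"
proof -
  have "(\<forall>k. norths (m @ [N]) k \<le> norths (v @ N # replicate j E) k) \<longleftrightarrow>
      (\<forall>k. norths m k \<le> norths v k)"
    if len: "length v + j = length m" and counts: "count_list v E + j = count_list m E"
  proof (intro iffI allI)
    fix k assume *: "\<forall>k. norths (m @ [N]) k \<le> norths (v @ N # replicate j E) k"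
    show "norths m k \<le> norths v k"
    proof (cases "k \<le> length v")
      case True
      then show ?thesis using spec[OF *, of k] len by (simp only: norths_snoc_N norths_insert_N) simp
    next
      case False
      then show ?thesis
        using len counts count_N_E[of v] count_N_E[of m] norths_le_total[of k m] by simp
    qed
  next
    fix k assume "\<forall>k. norths m k \<le> norths v k"
    then show "norths (m @ [N]) k \<le> norths (v @ N # replicate j E) k"
      using len unfolding norths_snoc_N norths_insert_N by (simp add: add_le_mono)
  qed
  then show ?thesis
    unfolding above_def norths_append_replicate_E
    by (simp del: take_append) blast
qed

lemma above_snoc_N: "above (m @ [N]) (d @ [N]) \<longleftrightarrow> above m d"
  using above_insert_N[of m 0 d] by simp

lemma last_N_split:
  assumes "count_list p N > 0"
  obtains v j where "p = v @ N # replicate j E"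
proof -
  have "N \<in> set p" using assms by (metis count_notin less_irrefl)
  then obtain v w where vw: "p = v @ N # w" "N \<notin> set w" by (metis split_list_last)
  then have "w = replicate (length w) E"
    by (intro replicate_eqI) (auto, metis step.exhaust)
  then show ?thesis using that vw by metis
qed

lemma ends_with_N:
  assumes "length q = Suc k" "norths q k < count_list q N"
  obtains d where "q = d @ [N]"
proof -
  have q: "q = take k q @ [q ! k]"
    using assms(1) take_Suc_conv_app_nth[of k q] by simp
  then have "count_list q N = norths q k + count_list [q ! k] N"
    by (metis count_list_append)
  then show ?thesis using assms q that by (cases "q ! k") auto
qed

text \<open>The inserted step raises the upper border by one exactly on the antidiagonals beyond the
  length of \<open>v\<close>, where \<open>v\<close> is already at its full height. So precisely one
  row appears, above all others.\<close>

lemma region_insert_N: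
  fixes v d :: path and j :: nat
  defines "P \<equiv> region (v @ N # replicate j E) (d @ [N])"
  assumes above: "above (v @ replicate j E) d"
  shows "topmost_row P = {count_list v E..count_list d E} \<times> {Suc (count_list v N)}"
    and "P - topmost_row P = region (v @ replicate j E) d"
proof -
  have counts: "count_list v N = count_list d N" "count_list v E + j = count_list d E"
    and len: "length v + j = length d"
    using above_count[OF above, of N] above_count[OF above, of E] above_length[OF above] by simp_all
  have "above (v @ N # replicate j E) (d @ [N])"
    using above by (simp add: above_insert_N)
  from region_extent(3)[OF this] have max: "Max (snd ` P) = Suc (count_list v N)"
    by (simp add: P_def)
  have mem: "(x, y) \<in> P \<longleftrightarrow> x + y \<le> Suc (length d) \<and>
      norths d (x + y) + (if x + y \<le> length d then 0 else 1) \<le> y \<and>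
      y \<le> norths v (x + y) + (if x + y \<le> length v then 0 else 1)" for x y
    unfolding P_def region_def norths_snoc_N norths_insert_N using len by simp
  \<comment> \<open>At this height the lower border imposes nothing, and the upper border is high
    enough exactly beyond the length of \<open>v\<close>; the total length bounds \<open>x\<close>
    on the right.\<close>
  have top: "(x, Suc (count_list v N)) \<in> P \<longleftrightarrow> count_list v E \<le> x \<and> x \<le> count_list d E" for x
  proof -
    let ?k = "x + Suc (count_list v N)"
    have "norths d ?k + (if ?k \<le> length d then 0 else 1) \<le> Suc (count_list v N)"
      using norths_le_total[of ?k d] counts by simp
    moreover have "Suc (count_list v N) \<le> norths v ?k + (if ?k \<le> length v then 0 else 1) \<longleftrightarrow>
        length v < ?k"
      using norths_le_total[of ?k v] by (cases "?k \<le> length v") auto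
    ultimately have "(x, Suc (count_list v N)) \<in> P \<longleftrightarrow> ?k \<le> Suc (length d) \<and> length v < ?k"
      unfolding mem by blast
    also have "\<dots> \<longleftrightarrow> count_list v E \<le> x \<and> x \<le> count_list d E"
      using counts len count_N_E[of v] count_N_E[of d] by presburger
    finally show ?thesis .
  qed
  show row: "topmost_row P = {count_list v E..count_list d E} \<times> {Suc (count_list v N)}"
  proof (rule set_eqI)
    fix c :: cell
    have "c \<in> topmost_row P \<longleftrightarrow> (fst c, snd c) \<in> P \<and> snd c = Suc (count_list v N)"
      by (simp add: topmost_row_def max)
    then show "c \<in> topmost_row P \<longleftrightarrow>
        c \<in> {count_list v E..count_list d E} \<times> {Suc (count_list v N)}"
      using top[of "fst c"] by (cases c) auto
  qed
  have "(x, y) \<in> P - topmost_row P \<longleftrightarrow> (x, y) \<in> region (v @ replicate j E) d" for x y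
  proof -
    have "(x, y) \<in> P - topmost_row P \<longleftrightarrow> (x, y) \<in> P \<and> y \<noteq> Suc (count_list v N)"
      by (auto simp: topmost_row_def max)
    \<comment> \<open>On the new antidiagonal \<open>x + y = Suc (length d)\<close> the borders
      leave only a cell of the top row. On the others, excluding the top row undoes the raise of the
      upper bound.\<close>
    also have "\<dots> \<longleftrightarrow> x + y \<le> length d \<and> norths d (x + y) \<le> y \<and> y \<le> norths v (x + y)"
    proof -
      have "norths v (x + y) \<le> count_list v N"
        by (rule norths_le_total)
      moreover have "length v < x + y \<Longrightarrow> norths v (x + y) = count_list v N"
        "length d < x + y \<Longrightarrow> norths d (x + y) = count_list v N"
        using counts by simp_all
      moreover have "length v \<le> length d" using len by simp
      ultimately show ?thesis
        unfolding mem by presburger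
    qed
    also have "\<dots> \<longleftrightarrow> (x, y) \<in> region (v @ replicate j E) d"
      unfolding region_def norths_append_replicate_E using len by simp
    finally show ?thesis .
  qed
  then show "P - topmost_row P = region (v @ replicate j E) d" by auto
qed

text \<open>The two new \<open>N\<close> steps have the highest rank on their paths, so they match
  only each other. The parts before all earlier \<open>N\<close> steps, and the \<open>E\<close>
  steps of \<open>m\<close> and \<open>d\<close>, are unchanged.\<close>

lemma blocks_insert_N:
  assumes "count_list v N = count_list m N"
  shows "blocks (v @ N # replicate j E) (m @ [N]) (d @ [N]) =
    insert (Horizontal ({count_list v E..count_list m E} \<times> {Suc (count_list m N)}))
      (blocks (v @ replicate j E) m d)"
proof -
  have u': "is_step N (v @ N # replicate j E) x \<longleftrightarrow> is_step N v x \<or> x = v" for x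
    by (auto simp: is_step_append is_step_Cons is_step_replicate)
  have u: "is_step N (v @ replicate j E) x \<longleftrightarrow> is_step N v x" for x
    by (auto simp: is_step_append is_step_replicate)
  have m': "is_step N (m @ [N]) x \<longleftrightarrow> is_step N m x \<or> x = m" for x
    by (auto simp: is_step_append is_step_single)
  have E: "is_step E (w @ [N]) x \<longleftrightarrow> is_step E w x" for w x
    by (auto simp: is_step_append is_step_single)
  have "is_step N (v @ N # replicate j E) nu \<and> is_step N (m @ [N]) nm \<and> matched N nu nm \<longleftrightarrow>
      (nu = v \<and> nm = m) \<or>
      (is_step N (v @ replicate j E) nu \<and> is_step N m nm \<and> matched N nu nm)" for nu nm
    using is_step_count_less[of N v nu] is_step_count_less[of N m nm] assms
    unfolding u' m' u matched_def by auto
  then have "{Horizontal (R nu nm) | nu nm. is_step N (v @ N # replicate j E) nu \<and>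
        is_step N (m @ [N]) nm \<and> matched N nu nm} =
      insert (Horizontal (R v m)) {Horizontal (R nu nm) | nu nm.
        is_step N (v @ replicate j E) nu \<and> is_step N m nm \<and> matched N nu nm}" for R
    by auto
  from this[of "\<lambda>nu nm. {count_list nu E..count_list nm E} \<times> {Suc (count_list nm N)}"]
  show ?thesis
    unfolding blocks_def E by (simp only: Un_insert_left insert_commute)
qed

lemma remove_top_row:
  assumes "nilp_triple (Suc n) (p, m @ [N], q)"
  obtains u d where "nilp_triple n (u, m, d)"
    "region p q - topmost_row (region p q) = region u d"
    "blocks p (m @ [N]) q = insert (Horizontal (topmost_row (region p q))) (blocks u m d)"
proof -
  have pm: "above p (m @ [N])" and mq: "above (m @ [N]) q" and n: "length p = n"
    using assms by (auto simp: nilp_triple_iff)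
  obtain v j where p: "p = v @ N # replicate j E"
    using last_N_split[of p] above_count[OF pm, of N] by auto
  \<comment> \<open>\<open>q\<close> lies weakly below \<open>m @ [N]\<close>, so before its last
    step it has at most as many \<open>N\<close> steps as \<open>m\<close>; the missing one must be
    its last step.\<close>
  have "norths q (length m) < count_list q N"
    using above_norths[OF mq, of "length m"] above_count[OF mq, of N] by simp
  then obtain d where q: "q = d @ [N]"
    using ends_with_N[of q "length m"] above_length[OF mq] by auto
  have um: "above (v @ replicate j E) m" and md: "above m d"
    using pm mq by (simp_all add: p q above_insert_N above_snoc_N)
  note ud = above_trans[OF um md]
  have "count_list v N = count_list m N" "count_list m E = count_list d E"
    using above_count[OF um, of N] above_count[OF md, of E] by simp_all
  then have "blocks p (m @ [N]) q =
      insert (Horizontal (topmost_row (region p q))) (blocks (v @ replicate j E) m d)"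
    by (simp only: p q region_insert_N(1)[OF ud] blocks_insert_N)
  moreover have "nilp_triple n (v @ replicate j E, m, d)"
    using um md n by (simp add: nilp_triple_iff p)
  moreover have "region p q - topmost_row (region p q) = region (v @ replicate j E) d"
    unfolding p q by (rule region_insert_N(2)[OF ud])
  ultimately show ?thesis using that by blast
qed

text \<open>Converse of \<open>remove_top_row\<close>: a polyomino whose remainder is the region of
  \<open>u\<close> and \<open>d\<close>, and whose size is larger by one, can only arise by
  inserting the \<open>N\<close> steps.\<close>

lemma add_top_row:
  assumes P: "parallelogram_polyomino P" "polyomino_size P = Suc n"
    and nilp: "nilp_triple n (u, m, d)" and remainder: "P - topmost_row P = region u d"
  obtains p q where "nilp_triple (Suc n) (p, m @ [N], q)" "P = region p q"
    "blocks p (m @ [N]) q = insert (Horizontal (topmost_row P)) (blocks u m d)"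
proof -
  have um: "above u m" and md: "above m d" and n: "Suc (length u) = n"
    using nilp by (simp_all add: nilp_triple_iff)
  note ud = above_trans[OF um md]
  obtain p q where pq: "above p q" "P = region p q"
    using P(1) by (auto simp: parallelogram_polyomino_iff)
  have len: "length p = n" using P(2) pq polyomino_size_region by simp
  \<comment> \<open>The top-right cell of the remainder lies in \<open>P\<close> strictly below the
    top row. With the size, this leaves exactly one additional \<open>N\<close> and no additional
    \<open>E\<close>.\<close>
  have corner: "(count_list u E, count_list u N) \<in> P - topmost_row P"
    using corner_in_region[OF ud] remainder by simp
  then have "count_list u E \<le> count_list p E" "count_list u N \<le> count_list p N"
    "count_list u N \<noteq> count_list p N"
    using region_bounds[OF pq(1)] region_extent(3)[OF pq(1)] by (auto simp: pq topmost_row_def)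
  then have top: "count_list p N = Suc (count_list u N)"
    using count_N_E[of p] count_N_E[of u] len n by linarith
  then obtain v j where p: "p = v @ N # replicate j E"
    using last_N_split[of p] by auto
  \<comment> \<open>The corner lies above the lower border on its antidiagonal, so \<open>q\<close>
    has not yet made its last \<open>N\<close> step there, and only one step is left.\<close>
  have "norths q (length u) < count_list q N"
    using corner top count_N_E[of u] above_count[OF pq(1), of N]
    by (simp add: pq region_def add.commute)
  then obtain d' where q: "q = d' @ [N]"
    using ends_with_N[of q "length u"] above_length[OF pq(1)] len n by auto
  have ud': "above (v @ replicate j E) d'"
    using pq(1) by (simp add: p q above_insert_N)
  then have "region (v @ replicate j E) d' = region u d"
    using region_insert_N(2)[OF ud'] remainder by (simp add: pq p q)
  then have u: "u = v @ replicate j E" "d = d'"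
    using region_inject[OF ud' ud] by auto
  have "nilp_triple (Suc n) (p, m @ [N], q)"
    using um md len by (simp add: nilp_triple_iff p q u above_insert_N above_snoc_N)
  moreover have "count_list v N = count_list m N" "count_list m E = count_list d' E"
    using above_count[OF um, of N] above_count[OF md, of E] by (simp_all add: u)
  then have "blocks p (m @ [N]) q = insert (Horizontal (topmost_row P)) (blocks u m d)"
    by (simp only: pq p q u region_insert_N(1)[OF ud'] blocks_insert_N)
  ultimately show ?thesis using that pq by blast
qed

text \<open>The reflected triple ends its middle path with \<open>N\<close>; its top row is removed
  and the result reflected back.\<close>

lemma remove_rightmost_column:
  assumes "nilp_triple (Suc n) (p, m @ [E], q)"
  obtains u d where "nilp_triple n (u, m, d)"
    "region p q - rightmost_column (region p q) = region u d"
    "blocks p (m @ [E]) q = insert (Vertical (rightmost_column (region p q))) (blocks u m d)"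
proof -
  have pq: "above p q"
    using assms above_trans by (auto simp: nilp_triple_iff)
  have "nilp_triple (Suc n) (flip q, flip m @ [N], flip p)"
    using nilp_triple_flip[OF assms] by simp
  then obtain d u where nilp: "nilp_triple n (d, flip m, u)"
    and region: "region (flip q) (flip p) - topmost_row (region (flip q) (flip p)) = region d u"
    and blocks: "blocks (flip q) (flip m @ [N]) (flip p) =
      insert (Horizontal (topmost_row (region (flip q) (flip p)))) (blocks d (flip m) u)"
    by (rule remove_top_row)
  have du: "above d u" using nilp above_trans by (auto simp: nilp_triple_iff)
  have "region (flip u) (flip d) = prod.swap ` region d u"
    using region_flip[OF du] .
  also have "\<dots> = region p q - rightmost_column (region p q)"
    unfolding region[symmetric] region_flip[OF pq] topmost_row_swap
    by (simp add: image_set_diff[symmetric] swap_swap_image)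
  finally have "region p q - rightmost_column (region p q) = region (flip u) (flip d)" ..
  moreover have "blocks p (m @ [E]) q = flip_block ` blocks (flip q) (flip m @ [N]) (flip p)"
    using blocks_flip[of "flip p" "flip m @ [N]" "flip q"] by simp
  then have "blocks p (m @ [E]) q =
      insert (Vertical (rightmost_column (region p q))) (blocks (flip u) m (flip d))"
    using blocks_flip[of u "flip m" d]
    by (simp add: blocks region_flip[OF pq] topmost_row_swap swap_swap_image)
  ultimately show ?thesis
    using that nilp_triple_flip[OF nilp] by simp
qed

lemma add_rightmost_column:
  assumes P: "parallelogram_polyomino P" "polyomino_size P = Suc n"
    and nilp: "nilp_triple n (u, m, d)" and remainder: "P - rightmost_column P = region u d"
  obtains p q where "nilp_triple (Suc n) (p, m @ [E], q)" "P = region p q"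
    "blocks p (m @ [E]) q = insert (Vertical (rightmost_column P)) (blocks u m d)"
proof -
  have ud: "above u d"
    using nilp above_trans by (auto simp: nilp_triple_iff)
  have "prod.swap ` P - topmost_row (prod.swap ` P) = region (flip d) (flip u)"
    unfolding region_flip[OF ud] remainder[symmetric] topmost_row_swap
    by (simp add: image_set_diff)
  from add_top_row[OF parallelogram_polyomino_swap[OF P(1)] _ nilp_triple_flip[OF nilp] this]
  obtain q p where nilp': "nilp_triple (Suc n) (q, flip m @ [N], p)"
    and region: "prod.swap ` P = region q p"
    and blocks: "blocks q (flip m @ [N]) p =
      insert (Horizontal (topmost_row (prod.swap ` P))) (blocks (flip d) (flip m) (flip u))"
    using P(2) by (auto simp: polyomino_size_swap)
  have qp: "above q p"
    using nilp' above_trans by (auto simp: nilp_triple_iff)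
  have "P = region (flip p) (flip q)"
    unfolding region_flip[OF qp] region[symmetric] by (simp add: swap_swap_image)
  moreover have "blocks (flip p) (m @ [E]) (flip q) =
      insert (Vertical (rightmost_column P)) (blocks u m d)"
    using blocks_flip[of p "flip m @ [N]" q] blocks_flip[of "flip u" "flip m" "flip d"]
    by (simp add: blocks topmost_row_swap swap_swap_image)
  ultimately show ?thesis
    using that nilp_triple_flip[OF nilp'] by simp
qed

section \<open>Baxter slicings are exactly the regions of triples with their blocks\<close>

lemma nilp_triple_Nil: "nilp_triple n (u, [], d) \<longleftrightarrow> n = 1 \<and> u = [] \<and> d = []"
  by (auto simp: nilp_triple_iff above_def)

lemma region_Nil: "region [] [] = {(0, 0)}"
  by (auto simp: region_def)

lemma blocks_Nil: "blocks [] [] [] = {Single {(0, 0)}}"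
  by (auto simp: blocks_def is_step_def)

text \<open>Induction on \<open>m\<close> from its end, because its last step decides whether a row
  or a column is the outermost block.\<close>

lemma baxter_slicing_of_triple:
  "nilp_triple n (u, m, d) \<Longrightarrow> baxter_slicing n (region u d) (blocks u m d)"
proof (induction m arbitrary: n u d rule: rev_induct)
  case Nil
  then show ?case
    using baxter_slicing.single by (simp add: nilp_triple_Nil region_Nil blocks_Nil)
next
  case (snoc s m)
  then obtain k where n: "n = Suc k"
    by (auto simp: nilp_triple_iff)
  have ud: "above u d"
    using snoc.prems above_trans by (auto simp: nilp_triple_iff)
  have poly: "parallelogram_polyomino (region u d)" "polyomino_size (region u d) = Suc k"
    using ud snoc.prems polyomino_size_region[OF ud]
    by (auto simp: parallelogram_polyomino_iff nilp_triple_iff n)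
  show ?case
  proof (cases s)
    case N
    obtain u' d' where "nilp_triple k (u', m, d')"
      "region u d - topmost_row (region u d) = region u' d'"
      "blocks u (m @ [N]) d = insert (Horizontal (topmost_row (region u d))) (blocks u' m d')"
      using remove_top_row[OF snoc.prems[unfolded n N]] .
    then show ?thesis
      using baxter_slicing.horizontal[OF poly] snoc.IH[of k u' d'] by (simp add: n N)
  next
    case E
    obtain u' d' where "nilp_triple k (u', m, d')"
      "region u d - rightmost_column (region u d) = region u' d'"
      "blocks u (m @ [E]) d = insert (Vertical (rightmost_column (region u d))) (blocks u' m d')"
      using remove_rightmost_column[OF snoc.prems[unfolded n E]] .
    then show ?thesis
      using baxter_slicing.vertical[OF poly] snoc.IH[of k u' d'] by (simp add: n E)
  qed
qed

lemma triple_of_baxter_slicing: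
  "baxter_slicing n P S \<Longrightarrow> \<exists>u m d. nilp_triple n (u, m, d) \<and> P = region u d \<and> S = blocks u m d"
proof (induction rule: baxter_slicing.induct)
  case single
  then show ?case
    by (metis nilp_triple_Nil region_Nil blocks_Nil)
next
  case (horizontal P n S)
  from horizontal.IH obtain u m d where "nilp_triple n (u, m, d)"
    "P - topmost_row P = region u d" and S: "S = blocks u m d" by blast
  from add_top_row[OF horizontal.hyps(1,2) this(1,2)] show ?case
    unfolding S by metis
next
  case (vertical P n S)
  from vertical.IH obtain u m d where "nilp_triple n (u, m, d)"
    "P - rightmost_column P = region u d" and S: "S = blocks u m d" by blast
  from add_rightmost_column[OF vertical.hyps(1,2) this(1,2)] show ?case
    unfolding S by metis
qed

section \<open>The middle path\<close>

lemma is_step_prefix: "is_step s w v \<Longrightarrow> prefix v w"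
  by (auto simp: is_step_def dest: append_prefixD)

lemma is_step_prefix_trans: "is_step s x v \<Longrightarrow> prefix x w \<Longrightarrow> is_step s w v"
  by (auto simp: is_step_def)

lemma is_step_before:
  "is_step s w v \<Longrightarrow> prefix x w \<Longrightarrow> length v < length x \<Longrightarrow> prefix (v @ [s]) x"
  by (auto simp: is_step_def intro: prefix_length_prefix)

lemma prefix_count_le: "prefix v w \<Longrightarrow> count_list v s \<le> count_list w s"
  by (auto simp: prefix_def)

text \<open>A prefix with more letters \<open>s\<close> than precede a given \<open>s\<close> step
  must contain that step.\<close>

lemma prefix_after_step:
  assumes "is_step s w v" "prefix x w" "count_list v s < count_list x s"
  shows "prefix (v @ [s]) x"
proof (rule is_step_before[OF assms(1,2)], rule ccontr)
  assume "\<not> length v < length x"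
  then have "prefix x v"
    using assms(2) is_step_prefix[OF assms(1)] by (meson not_le_imp_less prefix_length_prefix)
  then show False using prefix_count_le assms(3) by (metis leD)
qed

text \<open>Since \<open>u\<close> is above \<open>m\<close>, its \<open>N\<close> step of a given
  rank comes no later than that of \<open>m\<close>. The parts before them have equally many
  \<open>N\<close> steps, so the earlier one has no more \<open>E\<close> steps. This makes the rows
  nonempty.\<close>

lemma matched_N_le:
  assumes "above u m" "is_step N u nu" "is_step N m nm" "matched N nu nm"
  shows "count_list nu E \<le> count_list nm E"
proof -
  have "take (Suc (length nm)) m = nm @ [N]"
    using assms(3) by (auto simp: is_step_def prefix_def)
  then have "Suc (count_list nu N) \<le> norths u (Suc (length nm))"
    using above_norths[OF assms(1), of "Suc (length nm)"] assms(4) by (simp add: matched_def)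
  then have "prefix (nu @ [N]) (take (Suc (length nm)) u)"
    by (intro prefix_after_step[OF assms(2)]) (auto simp: take_is_prefix)
  then have "length nu \<le> length nm"
    using prefix_length_le by fastforce
  then show ?thesis
    using assms(4) count_N_E[of nu] count_N_E[of nm] by (simp add: matched_def)
qed

lemma matched_E_le:
  assumes "above m d" "is_step E m em" "is_step E d ed" "matched E em ed"
  shows "count_list ed N \<le> count_list em N"
  using matched_N_le[of "flip d" "flip m" "flip ed" "flip em"]
    is_step_flip[OF assms(2)] is_step_flip[OF assms(3)] assms(1,4)
  by (simp add: matched_def)

lemma row_extent:
  assumes "a \<le> (b::nat)"
  shows "right_edge ({a..b} \<times> {c}) = Suc b" "Min (snd ` ({a..b} \<times> {c})) = c"
    "width ({a..b} \<times> {c}) = Suc (b - a)"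
proof -
  have "Max {a..b} = b" "Min {a..b} = a"
    using assms by (auto intro: Max_eqI Min_eqI)
  then show "right_edge ({a..b} \<times> {c}) = Suc b" "Min (snd ` ({a..b} \<times> {c})) = c"
    "width ({a..b} \<times> {c}) = Suc (b - a)"
    using assms by (simp_all add: right_edge_def width_def)
qed

lemma column_extent:
  assumes "a \<le> (b::nat)"
  shows "Min (fst ` ({c} \<times> {a..b})) = c" "Max (snd ` ({c} \<times> {a..b})) = b"
  using assms by (auto intro: Max_eqI)

lemma Horizontal_in_blocks:
  "Horizontal B \<in> blocks u m d \<longleftrightarrow> (\<exists>nu nm. is_step N u nu \<and> is_step N m nm \<and> matched N nu nm \<and>
     B = {count_list nu E..count_list nm E} \<times> {Suc (count_list nm N)})"
  by (auto simp: blocks_def)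

lemma Vertical_in_blocks:
  "Vertical B \<in> blocks u m d \<longleftrightarrow> (\<exists>em ed. is_step E m em \<and> is_step E d ed \<and> matched E em ed \<and>
     B = {Suc (count_list em E)} \<times> {count_list ed N..count_list em N})"
  by (auto simp: blocks_def)

text \<open>The row is given by the \<open>N\<close> steps whose rank is the number of
  \<open>N\<close> steps before \<open>em\<close>. Membership in the region puts the cell to the
  right of the row's left end, and on \<open>m\<close> this \<open>N\<close> step comes after the
  \<open>E\<close> step, so the row reaches the cell.\<close>

lemma cell_above_E_step:
  assumes um: "above u m" and em: "is_step E m em"
    and cell: "(Suc (count_list em E), Suc (count_list em N)) \<in> region u d"
  shows "\<exists>B. Horizontal B \<in> blocks u m d \<and> (Suc (count_list em E), Suc (count_list em N)) \<in> B"
proof -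
  let ?i = "count_list em N" and ?x = "Suc (count_list em E)"
  have norths: "Suc ?i \<le> norths u (?x + Suc ?i)"
    using cell by (simp add: region_def)
  then have "?i < count_list u N"
    using norths_le_total[of "?x + Suc ?i" u] by simp
  then obtain nu nm where nu: "is_step N u nu" "count_list nu N = ?i"
    and nm: "is_step N m nm" "count_list nm N = ?i"
    using is_step_at_rank[of ?i u N] is_step_at_rank[of ?i m N] above_count[OF um, of N] by metis
  have "prefix (nu @ [N]) (take (?x + Suc ?i) u)"
    using nu norths by (intro prefix_after_step[OF nu(1)]) (auto simp: take_is_prefix)
  then have "Suc (length nu) \<le> ?x + Suc ?i"
    using prefix_length_le by fastforce
  then have "count_list nu E \<le> ?x"
    using count_N_E[of nu] nu(2) by simp
  moreover have "length em < length nm"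
  proof (rule ccontr)
    assume le: "\<not> length em < length nm"
    show False
    proof (cases "length em = length nm")
      case True
      then show False using em nm(1) by (auto simp: is_step_iff)
    next
      case False
      then have "prefix (nm @ [N]) em"
        using le is_step_before[OF nm(1) is_step_prefix[OF em]] by simp
      then show False using prefix_count_le[of "nm @ [N]" em N] nm(2) by simp
    qed
  qed
  then have "?x \<le> count_list nm E"
    using is_step_before[OF em is_step_prefix[OF nm(1)]] prefix_count_le[of "em @ [E]" nm E] by simp
  moreover have "Horizontal ({count_list nu E..count_list nm E} \<times> {Suc (count_list nm N)})
      \<in> blocks u m d"
    unfolding Horizontal_in_blocks using nu nm by (metis matched_def)
  ultimately show ?thesis using nm(2) by fastforce
qed

lemma cell_right_of_N_step:
  assumes md: "above m d" and ud: "above u d" and nm: "is_step N m nm"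
    and cell: "(Suc (count_list nm E), Suc (count_list nm N)) \<in> region u d"
  shows "\<exists>B. Vertical B \<in> blocks u m d \<and> (Suc (count_list nm E), Suc (count_list nm N)) \<in> B"
proof -
  have "(Suc (count_list nm N), Suc (count_list nm E)) \<in> region (flip d) (flip u)"
    using cell by (simp add: region_flip[OF ud])
  then obtain B where B: "Horizontal B \<in> blocks (flip d) (flip m) (flip u)"
    "(Suc (count_list nm N), Suc (count_list nm E)) \<in> B"
    using cell_above_E_step[of "flip d" "flip m" "flip nm" "flip u"] md is_step_flip[OF nm] by auto
  then have "flip_block (Horizontal B) \<in> blocks u m d"
    unfolding blocks_flip by (metis flip_block_flip_block image_iff)
  then show ?thesis using B(2) by (intro exI[of _ "prod.swap ` B"]) simp
qed

text \<open>Membership in \<open>{u, m}\<close> allows passing from either path to the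
  other.\<close>

lemma obtain_matched:
  assumes "above u m" "is_step s w v" "w \<in> {u, m}" "w' \<in> {u, m}"
  obtains v' where "is_step s w' v'" "count_list v' s = count_list v s"
proof -
  have "count_list w s = count_list w' s"
    using assms(3,4) above_count[OF assms(1), of s] by auto
  then have "count_list v s < count_list w' s"
    using is_step_count_less[OF assms(2)] by simp
  then show ?thesis using is_step_at_rank that by blast
qed

text \<open>The prescribed block corners are the starting points of steps of \<open>m\<close>: of an
  \<open>N\<close> step for a row, of an \<open>E\<close> step for a column.\<close>

lemma follows_blocks_middle:
  assumes um: "above u m" and md: "above m d"
  shows "follows_blocks (region u d) (blocks u m d) m"
proof -
  note ud = above_trans[OF um md]
  have "(right_edge B, Min (snd ` B)) \<in> vertices (1, 1) m" if B: "Horizontal B \<in> blocks u m d" for B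
  proof -
    obtain nu nm where nm: "is_step N m nm" and "is_step N u nu" "matched N nu nm"
      and B': "B = {count_list nu E..count_list nm E} \<times> {Suc (count_list nm N)}"
      using B by (auto simp: Horizontal_in_blocks)
    then have "(right_edge B, Min (snd ` B)) = endpoint (1, 1) nm"
      using matched_N_le[OF um] by (simp add: B' row_extent endpoint_def del: snd_image_times)
    then show ?thesis
      using is_step_prefix[OF nm] by (auto simp: vertices_def)
  qed
  moreover have "(Min (fst ` B), Suc (Max (snd ` B))) \<in> vertices (1, 1) m"
    if B: "Vertical B \<in> blocks u m d" for B
  proof -
    obtain em ed where em: "is_step E m em" and "is_step E d ed" "matched E em ed"
      and B': "B = {Suc (count_list em E)} \<times> {count_list ed N..count_list em N}"
      using B by (auto simp: Vertical_in_blocks)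
    then have "(Min (fst ` B), Suc (Max (snd ` B))) = endpoint (1, 1) em"
      using matched_E_le[OF md]
      by (simp add: B' column_extent endpoint_def del: fst_image_times snd_image_times)
    then show ?thesis
      using is_step_prefix[OF em] by (auto simp: vertices_def)
  qed
  moreover have "endpoint (1, 1) m = (Suc (count_list u E), Suc (count_list u N))"
    using above_count[OF um] by (simp add: endpoint_def)
  ultimately show ?thesis
    using cell_above_E_step[OF um] cell_right_of_N_step[OF md ud]
    by (auto simp: follows_blocks_def region_extent[OF ud] step_starts_def endpoint_def)
qed

text \<open>Every vertex of \<open>m\<close> is forced on \<open>m'\<close>: those starting a step
  by the block corners, the last by the endpoint. A path has one vertex per antidiagonal, which
  leaves no room for others.\<close>

lemma follows_blocks_unique:
  assumes um: "above u m" and md: "above m d"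
    and follows: "follows_blocks (region u d) (blocks u m d) m'"
  shows "m' = m"
proof -
  note ud = above_trans[OF um md]
  have "endpoint (1, 1) m' = endpoint (1, 1) m"
    using follows above_count[OF um]
    by (simp add: follows_blocks_def region_extent[OF ud] endpoint_def)
  then have len: "length m' = length m" and counts: "count_list m' N = count_list m N"
    using count_N_E[of m] count_N_E[of m'] by (auto simp: endpoint_def)
  have vertex: "endpoint (1, 1) (take k m) \<in> vertices (1, 1) m'" if k: "k < length m" for k
  proof (cases "m ! k")
    case N
    then have nm: "is_step N m (take k m)" using k by (auto simp: is_step_iff)
    obtain nu where nu: "is_step N u nu" "count_list nu N = norths m k"
      using obtain_matched[OF um nm] by blast
    let ?B = "{count_list nu E..easts m k} \<times> {Suc (norths m k)}"
    have "Horizontal ?B \<in> blocks u m d"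
      using nm nu unfolding Horizontal_in_blocks matched_def by blast
    moreover have "count_list nu E \<le> easts m k"
      using matched_N_le[OF um nu(1) nm] nu(2) by (simp add: matched_def)
    then have "(right_edge ?B, Min (snd ` ?B)) = endpoint (1, 1) (take k m)"
      by (simp add: row_extent endpoint_def del: snd_image_times)
    ultimately show ?thesis
      using follows unfolding follows_blocks_def by metis
  next
    case E
    then have em: "is_step E m (take k m)" using k by (auto simp: is_step_iff)
    obtain ed where ed: "is_step E d ed" "count_list ed E = easts m k"
      using obtain_matched[OF md em] by blast
    let ?B = "{Suc (easts m k)} \<times> {count_list ed N..norths m k}"
    have "Vertical ?B \<in> blocks u m d"
      using em ed unfolding Vertical_in_blocks matched_def by metis
    moreover have "count_list ed N \<le> norths m k"
      using matched_E_le[OF md em ed(1)] ed(2) by (simp add: matched_def)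
    then have "(Min (fst ` ?B), Suc (Max (snd ` ?B))) = endpoint (1, 1) (take k m)"
      by (simp add: column_extent endpoint_def del: fst_image_times snd_image_times)
    ultimately show ?thesis
      using follows unfolding follows_blocks_def by metis
  qed
  show ?thesis
  proof (rule path_eqI[OF len])
    fix k assume k: "k \<le> length m'"
    show "norths m' k = norths m k"
    proof (cases "k = length m'")
      case True
      then show ?thesis using len counts by simp
    next
      case False
      then have "endpoint (1, 1) (take k m) \<in> vertices (1, 1) m'" using vertex k len by simp
      then obtain l where l: "l \<le> length m'" "easts m' l = easts m k" "norths m' l = norths m k"
        by (auto simp: vertices_eq endpoint_def)
      then have "l = k"
        using norths_easts[of l m'] norths_easts[of k m] k len by simp
      then show ?thesis using l by simp
    qed
  qed
qed

lemma slicing_to_triple_inverse: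
  assumes "nilp_triple n (u, m, d)"
  shows "slicing_to_triple (region u d, blocks u m d) = (u, m, d)"
proof -
  have um: "above u m" and md: "above m d"
    using assms by (simp_all add: nilp_triple_iff)
  have "middle_path (region u d) (blocks u m d) = m"
    unfolding middle_path_def
    using follows_blocks_middle[OF um md] follows_blocks_unique[OF um md] by (rule the_equality)
  then show ?thesis
    by (simp add: slicing_to_triple_def borders_region[OF above_trans[OF um md]])
qed


section \<open>The Schroeder conditions\<close>

text \<open>Runs of \<open>E\<close> at the end are closed under shortening and bounded by the
  length, so the greatest one exists and decides all smaller lengths.\<close>

lemma le_east_run_iff: "j \<le> east_run w \<longleftrightarrow> suffix (replicate j E) w"
proof -
  have bound: "k \<le> length w" if "suffix (replicate k E) w" for k
    using suffix_length_le[OF that] by simp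
  have *: "suffix (replicate (east_run w) E) w"
    unfolding east_run_def by (rule GreatestI_nat[of _ 0 "length w"]) (auto simp: bound)
  show ?thesis
  proof
    assume "j \<le> east_run w"
    then have "replicate (east_run w) E = replicate (east_run w - j) E @ replicate j E"
      by (simp add: replicate_add[symmetric])
    then have "suffix (replicate j E) (replicate (east_run w) E)" by (simp add: suffix_def)
    then show "suffix (replicate j E) w" using * suffix_order.trans by blast
  next
    assume "suffix (replicate j E) w"
    then show "j \<le> east_run w"
      unfolding east_run_def by (rule Greatest_le_nat) (rule bound)
  qed
qed

text \<open>The lower border has one more initial \<open>E\<close> step than \<open>d\<close>, which lengthens the run at an
  \<open>E\<close> step of \<open>d\<close> only if this run reaches back to the origin. Widths are too small for this
  to matter.\<close>

lemma le_east_run_Cons: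
  assumes "j \<le> count_list w E"
  shows "j \<le> east_run (E # w) \<longleftrightarrow> j \<le> east_run w"
proof -
  have "replicate j E \<noteq> E # w"
  proof
    assume "replicate j E = E # w"
    then have "count_list (replicate j E) E = count_list (E # w) E" by simp
    then show False using assms by simp
  qed
  then show ?thesis by (simp add: le_east_run_iff suffix_Cons)
qed

text \<open>The lowest border point at an abscissa is where the border first arrives there, namely
  the end of the \<open>E\<close> step leading to it.\<close>

lemma r_value_eq:
  assumes v: "is_step E (lower_border P) v" and edge: "right_edge B = Suc (count_list v E)"
  shows "r_value P B = east_run (v @ [E])"
proof -
  let ?D = "lower_border P"
  have prefix: "prefix (v @ [E]) ?D" using v by (simp add: is_step_def)
  have "count_list v N \<le> y" if y: "(right_edge B, y) \<in> vertices (0, 0) ?D" for y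
  proof -
    obtain x where x: "prefix x ?D" "count_list x E = Suc (count_list v E)" "count_list x N = y"
      using y edge by (auto simp: vertices_def endpoint_def)
    then have "prefix (v @ [E]) x" using prefix_after_step[OF v] by simp
    then show ?thesis using prefix_count_le[of "v @ [E]" x N] x by simp
  qed
  moreover have "(right_edge B, count_list v N) \<in> vertices (0, 0) ?D"
    using prefix by (auto simp: vertices_def endpoint_def edge intro!: exI[of _ "v @ [E]"])
  ultimately have "(LEAST y. (right_edge B, y) \<in> vertices (0, 0) ?D) = count_list v N"
    by (intro Least_equality) auto
  then have X: "X_point P B = endpoint (0, 0) (v @ [E])"
    by (simp add: X_point_def edge endpoint_def)
  \<comment> \<open>The coordinates of the end of a prefix give its length, hence the
    prefix.\<close>
  have "(THE x. prefix x ?D \<and> endpoint (0, 0) x = X_point P B) = v @ [E]"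
  proof (rule the_equality)
    fix x assume x: "prefix x ?D \<and> endpoint (0, 0) x = X_point P B"
    then have "length x = length (v @ [E])"
      using count_N_E[of x] count_N_E[of "v @ [E]"] by (simp add: X endpoint_def)
    then show "x = v @ [E]"
      using x prefix by (metis prefix_length_prefix prefix_order.antisym order_refl)
  qed (use prefix X in simp)
  then show ?thesis by (simp add: r_value_def)
qed

text \<open>Replaces comparison of positions by comparison of ranks, which combines directly with
  \<open>matched\<close>.\<close>

lemma last_step_iff: "last_step s w v \<longleftrightarrow> is_step s w v \<and> Suc (count_list v s) = count_list w s"
proof
  assume *: "last_step s w v"
  then have v: "is_step s w v" by (simp add: last_step_def)
  have "\<not> Suc (count_list v s) < count_list w s"
  proof
    assume "Suc (count_list v s) < count_list w s"
    then obtain x where x: "is_step s w x" "count_list x s = Suc (count_list v s)"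
      by (rule is_step_at_rank)
    then have "prefix (v @ [s]) x"
      using prefix_after_step[OF v is_step_prefix[OF x(1)]] by simp
    then show False
      using * x(1) prefix_length_le[of "v @ [s]" x] by (fastforce simp: last_step_def)
  qed
  then show "is_step s w v \<and> Suc (count_list v s) = count_list w s"
    using v is_step_count_less[OF v] by simp
next
  assume *: "is_step s w v \<and> Suc (count_list v s) = count_list w s"
  have "length x \<le> length v" if "is_step s w x" for x
  proof (rule ccontr)
    assume "\<not> length x \<le> length v"
    then have "prefix (v @ [s]) x"
      using is_step_before[of s w v x] * is_step_prefix[OF that] by simp
    then show False
      using prefix_count_le[of "v @ [s]" x s] is_step_count_less[OF that] * by simp
  qed
  then show "last_step s w v" using * by (simp add: last_step_def)
qed

lemma schroeder_slicing_iff: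
  assumes nilp: "nilp_triple n (u, m, d)"
  shows "schroeder_slicing n (region u d) (blocks u m d) \<longleftrightarrow> schroeder_triple n (u, m, d)"
proof -
  have um: "above u m" and md: "above m d"
    using nilp by (simp_all add: nilp_triple_iff)
  note ud = above_trans[OF um md]
  have width_iff: "width B \<le> r_value (region u d) B + 1 \<longleftrightarrow>
      int (count_list nm E) - int (count_list nu E) \<le> int (east_run (ed @ [E]))"
    if steps: "is_step N u nu" "is_step N m nm" "matched N nu nm"
      "last_step E nm em" "is_step E d ed" "matched E em ed"
      and B: "B = {count_list nu E..count_list nm E} \<times> {Suc (count_list nm N)}"
    for nu nm em ed B
  proof -
    let ?j = "count_list nm E - count_list nu E"
    have le: "count_list nu E \<le> count_list nm E"
      using matched_N_le[OF um steps(1-3)] .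
    have count: "Suc (count_list ed E) = count_list nm E"
      using steps(4,6) by (simp add: last_step_iff matched_def)
    \<comment> \<open>The right edge of the row is one more than the number of \<open>E\<close>
      steps before \<open>nm\<close>. The initial \<open>E\<close> of the lower border makes up for
      this one, so the border arrives there by \<open>E_d\<close>.\<close>
    have "is_step E (E # d @ [N]) (E # ed)"
      using steps(5) by (auto simp: is_step_Cons is_step_append)
    then have "r_value (region u d) B = east_run (E # ed @ [E])"
      using r_value_eq[of "region u d" "E # ed" B] count
      by (simp add: borders_region[OF ud] B row_extent[OF le])
    \<comment> \<open>The width is \<open>?j + 1\<close>, and \<open>?j\<close> is at most the
      number of \<open>E\<close> steps in \<open>ed @ [E]\<close>; hence the initial
      \<open>E\<close> of the border does not affect the comparison.\<close>
    then have "width B \<le> r_value (region u d) B + 1 \<longleftrightarrow> ?j \<le> east_run (ed @ [E])"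
      using le_east_run_Cons[of ?j "ed @ [E]"] count by (simp add: B row_extent[OF le])
    then show ?thesis using le by auto
  qed
  have "(\<forall>B. Horizontal B \<in> blocks u m d \<longrightarrow> width B \<le> r_value (region u d) B + 1) \<longleftrightarrow>
    (\<forall>nu nm em ed. is_step N u nu \<and> is_step N m nm \<and> matched N nu nm \<and>
       last_step E nm em \<and> is_step E d ed \<and> matched E em ed \<longrightarrow>
       int (count_list nm E) - int (count_list nu E) \<le> int (east_run (ed @ [E])))"
    (is "?L \<longleftrightarrow> ?R")
  proof
    assume L: ?L
    show ?R
    proof (intro allI impI, elim conjE)
      fix nu nm em ed
      assume steps: "is_step N u nu" "is_step N m nm" "matched N nu nm"
        "last_step E nm em" "is_step E d ed" "matched E em ed"
      let ?B = "{count_list nu E..count_list nm E} \<times> {Suc (count_list nm N)}"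
      have "Horizontal ?B \<in> blocks u m d"
        using steps unfolding Horizontal_in_blocks by blast
      then show "int (count_list nm E) - int (count_list nu E) \<le> int (east_run (ed @ [E]))"
        using L width_iff[OF steps refl] by blast
    qed
  next
    assume R: ?R
    show ?L
    proof (intro allI impI)
      fix B assume "Horizontal B \<in> blocks u m d"
      then obtain nu nm where steps: "is_step N u nu" "is_step N m nm" "matched N nu nm"
        and B: "B = {count_list nu E..count_list nm E} \<times> {Suc (count_list nm N)}"
        unfolding Horizontal_in_blocks by blast
      have le: "count_list nu E \<le> count_list nm E"
        using matched_N_le[OF um steps] .
      show "width B \<le> r_value (region u d) B + 1"
      \<comment> \<open>With no \<open>E\<close> step before \<open>N_m\<close> the row is a single
        cell and the bound is trivial, in accordance with the triple condition requiring nothing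
        there.\<close>
      proof (cases "count_list nm E")
        case 0
        have "width B = Suc (count_list nm E - count_list nu E)"
          by (simp add: B row_extent[OF le])
        then show ?thesis by (simp add: 0)
      next
        case (Suc k)
        then obtain em where em: "is_step E nm em" "count_list em E = k"
          using is_step_at_rank[of k nm E] by auto
        then have "is_step E m em"
          using is_step_prefix_trans is_step_prefix[OF steps(2)] by blast
        then obtain ed where ed: "is_step E d ed" "count_list ed E = count_list em E"
          using obtain_matched[OF md] by blast
        have "last_step E nm em" "matched E em ed"
          using em ed Suc by (simp_all add: last_step_iff matched_def)
        then show ?thesis
          using R width_iff[OF steps _ ed(1) _ B] steps ed(1) by blast
      qed
    qed
  qed
  then show ?thesis
    using nilp baxter_slicing_of_triple[OF nilp]
    by (simp add: schroeder_slicing_def schroeder_triple_def)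
qed

theorem theorem6:
  shows "slicing_to_triple ` (\<Union>n. schroeder_slicings n) = (\<Union>n. schroeder_triples n) \<and>
         bij_betw slicing_to_triple (\<Union>n. schroeder_slicings n) (\<Union>n. schroeder_triples n) \<and>
         (\<forall>n. slicing_to_triple ` schroeder_slicings n \<subseteq> schroeder_triples n)"
proof -
  \<comment> \<open>The explicit inverse of the map; the size is the same on both sides.\<close>
  define slicing where "slicing = (\<lambda>(u, m, d). (region u d, blocks u m d))"
  have forth: "slicing t \<in> schroeder_slicings n" "slicing_to_triple (slicing t) = t"
    if "t \<in> schroeder_triples n" for t n
  proof -
    obtain u m d where t: "t = (u, m, d)" by (cases t)
    then have "nilp_triple n (u, m, d)"
      using that by (simp add: schroeder_triples_def schroeder_triple_def)
    then show "slicing t \<in> schroeder_slicings n" "slicing_to_triple (slicing t) = t"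
      using that schroeder_slicing_iff slicing_to_triple_inverse
      by (auto simp: t slicing_def schroeder_slicings_def schroeder_triples_def)
  qed
  have converse: "slicing_to_triple c \<in> schroeder_triples n" "slicing (slicing_to_triple c) = c"
    if c: "c \<in> schroeder_slicings n" for c n
  proof -
    obtain u m d where nilp: "nilp_triple n (u, m, d)" and c': "c = (region u d, blocks u m d)"
      using c triple_of_baxter_slicing
      by (fastforce simp: schroeder_slicings_def schroeder_slicing_def)
    then show "slicing_to_triple c \<in> schroeder_triples n" "slicing (slicing_to_triple c) = c"
      using c schroeder_slicing_iff[OF nilp] slicing_to_triple_inverse[OF nilp]
      by (auto simp: c' slicing_def schroeder_slicings_def schroeder_triples_def)
  qed
  have "bij_betw slicing_to_triple (\<Union>n. schroeder_slicings n) (\<Union>n. schroeder_triples n)"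
  proof (rule bij_betw_byWitness[where f' = slicing])
    show "\<forall>c\<in>\<Union>n. schroeder_slicings n. slicing (slicing_to_triple c) = c"
      using converse(2) by auto
    show "\<forall>t\<in>\<Union>n. schroeder_triples n. slicing_to_triple (slicing t) = t"
      using forth(2) by auto
    show "slicing_to_triple ` (\<Union>n. schroeder_slicings n) \<subseteq> (\<Union>n. schroeder_triples n)"
      using converse(1) by (intro image_subsetI) (elim UN_E, intro UN_I)
    show "slicing ` (\<Union>n. schroeder_triples n) \<subseteq> (\<Union>n. schroeder_slicings n)"
      using forth(1) by (intro image_subsetI) (elim UN_E, intro UN_I)
  qed
  then show ?thesis
    using converse(1) by (intro conjI allI image_subsetI) (simp_all only: bij_betw_def)
qed

end
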